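(* Let $G$ be a finite group, $\mathcal C\subset G$ a conjugacy class, $r\in\mathcal C$ with centraliser $C_G$, and $\pi$ an irreducible complex representation of $C_G$ on $V_\pi$. Let $W$ be a right $D^\vee(G)$-comodule whose pushout to an $H$-comodule contains $V_{r,\pi}$, and let $E\cong V_{\mathcal C,\pi}$ be as in the context. Let $\square:\mathbb CG\to\mathbb CG$ be a regular $D^\vee(G)$-covariant $\star$-compatible Laplacian specified by real eigenvalues $\{\lambda_{\mathcal D}\}$ indexed by the conjugacy classes $\mathcal D$ of $G$. Then there is an isomorphism of left $D^\vee(G)$-comodules $$E\cong\{s\in\mathbb CG\otimes W\ |\ ((\square-\lambda_{\mathcal C^{-1}})\otimes\mathrm{id}_W)s=0\ \text{ and }\ P^{cov}_{r,\pi}s=s\}\subseteq\mathbb CG\otimes W.$$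
   Context: $\mathbb C(G)$ denotes functions on $G$ with basis $\delta_g$, $\mathbb CG$ the group algebra, $e$ the identity. $D^\vee(G)$ is the Hopf algebra on $\mathbb C(G)\otimes\mathbb CG$ with tensor product algebra and counit and $\Delta(\delta_g\otimes h)=\sum_{f\in G}\delta_f\otimes f^{-1}ghg^{-1}f\otimes\delta_{f^{-1}g}\otimes h$, $S(\delta_g\otimes h)=\delta_{g^{-1}}\otimes gh^{-1}g^{-1}$. Right $D^\vee(G)$-comodules $W$ are $G$-crossed modules ($G$-graded, with left $G$-action, $|g\triangleright w|=g|w|g^{-1}$), with coaction $\Delta_Rw=\sum_gg\triangleright w\otimes\delta_g\otimes|w|$. $D(G)$ is the algebra on $\mathbb C(G)\otimes\mathbb CG$ with product $(\delta_g\otimes h)(\delta_u\otimes v)=\delta_{g,huh^{-1}}\delta_g\otimes hv$, acting on $W$ by $(\delta_g\otimes h)\triangleright w=\delta_{g,h|w|h^{-1}}h\triangleright w$. $H=\mathbb C(C_G)\otimes\mathbb CG$ is the quotient Hopf algebra of $D^\vee(G)$ by $p:\delta_g\otimes h\mapsto\delta_g\otimes h$ if $g\in C_G$, else $0$; pushout means composing a coaction with $p$. $V_{r,\pi}=V_\pi$ with right $H$-coaction $v\mapsto\sum_{g\in C_G}\pi(g)v\otimes\delta_g\otimes r$. $E=(D^\vee(G)\otimes V_{r,\pi})^H$ is the space of invariants of the tensor product $H$-coaction ($D^\vee(G)$ having coaction $(\mathrm{id}\otimes p)\Delta$), a left $D^\vee(G)$-comodule via the coproduct of $D^\vee(G)$;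 it corresponds to the irreducible $D(G)$-module $V_{\mathcal C,\pi}=\mathbb C\mathcal C\otimes V_\pi$ with action $(\delta_g\otimes h)\triangleright(c\otimes v)=\delta_{g,hch^{-1}}\,hch^{-1}\otimes\pi(q_{hch^{-1}}^{-1}hq_c)v$. $\mathbb CG\otimes W$ is a left $D^\vee(G)$-comodule by $g\otimes w\mapsto\sum_f\delta_f\otimes f^{-1}gf\otimes f^{-1}gf\otimes f^{-1}\triangleright w$. $q:\mathcal C\to G$ is a fixed map with $q_crq_c^{-1}=c$, $q_r=e$. $P_{r,\pi}=\delta_r\otimes P_\pi\in D(G)$ with $P_\pi=\frac{\dim V_\pi}{|C_G|}\sum_{n\in C_G}\mathrm{Tr}_\pi(n^{-1})n$. On $\mathbb C\mathcal C^{-1}\otimes W$ one sets $P^{cov}_{r,\pi}(c^{-1}\otimes w)=c^{-1}\otimes(q_cP_{r,\pi}q_c^{-1})\triangleright w$ for $c\in\mathcal C$, and this is extended to $\mathbb CG\otimes W$ by $P^{cov}_{r,\pi}(g\otimes w)=g\otimes(q_gP_{r,\pi}q_g^{-1})\triangleright w$, where $q_g$ is defined with respect to a representative $r'$ of the conjugacy class of $g$ (so $q_gr'q_g^{-1}=g$). A $D^\vee(G)$-covariant operator $\square$ on $\mathbb CG$ is one commuting with the left coaction $g\mapsto\sum_f\delta_f\otimes f^{-1}gf\otimes f^{-1}gf$; it has the form $\square g=\lambda_{\mathcal C_g}g$ with $\mathcal C_g$ the conjugacy class of $g$. It is regular if $\lambda_{\mathcal D}\in\mathbb R$, $\lambda_{\mathcal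 D}=\lambda_{\mathcal D^{-1}}$, $\lambda_{\{e\}}=0$ and the $\lambda_{\mathcal D}$ are otherwise distinct. $\star$-compatible means commuting with the antilinear map $g\mapsto g^{-1}$.
   Formalization: V_{r,π} is assumed to occur in the pushout of W with multiplicity exactly one, and the isomorphism with the full solution space is claimed only if C = C^{-1}; for general C it is with the solutions supported on C^{-1}, as the literal claim fails otherwise (e.g. G = Z/3). *)

theory Defs
  imports Complex_Main "HOL-Algebra.Coset" "HOL-Library.Function_Algebras"
begin

text \<open>
  Complex vector spaces are types \<open>'v :: ab_group_add\<close> with an explicit scalar multiplication
  \<open>complex \<Rightarrow> 'v \<Rightarrow> 'v\<close> satisfying \<open>vector_space\<close>.  All Hopf algebras here have a
  distinguished finite basis \<open>B \<subseteq> 'i\<close>.  An element of \<open>A \<otimes> V\<close> (or \<open>V \<otimes> A\<close>), where \<open>A\<close> has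
  basis \<open>B\<close>, is the family of its \<open>V\<close>-valued coefficients: a function \<open>'i \<Rightarrow> 'v\<close> vanishing
  outside \<open>B\<close>.  In particular a coaction is a function \<open>'v \<Rightarrow> 'i \<Rightarrow> 'v\<close>.
\<close>

subsection \<open>Linear algebra\<close>

definition fscale :: "(complex \<Rightarrow> 'v \<Rightarrow> 'v) \<Rightarrow> complex \<Rightarrow> ('i \<Rightarrow> 'v) \<Rightarrow> ('i \<Rightarrow> 'v)" where
  "fscale s a x = (\<lambda>i. s a (x i))"

definition linear_map_on ::
  "(complex \<Rightarrow> 'm::ab_group_add \<Rightarrow> 'm) \<Rightarrow> 'm set \<Rightarrow>
   (complex \<Rightarrow> 'n::ab_group_add \<Rightarrow> 'n) \<Rightarrow> 'n set \<Rightarrow> ('m \<Rightarrow> 'n) \<Rightarrow> bool" where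
  "linear_map_on sM M sN N f \<longleftrightarrow>
     (\<forall>x\<in>M. f x \<in> N) \<and>
     (\<forall>x\<in>M. \<forall>y\<in>M. f (x + y) = f x + f y) \<and>
     (\<forall>a. \<forall>x\<in>M. f (sM a x) = sN a (f x))"

text \<open>Only meaningful on finite-dimensional spaces.\<close>

definition lin_trace :: "(complex \<Rightarrow> 'v::ab_group_add \<Rightarrow> 'v) \<Rightarrow> ('v \<Rightarrow> 'v) \<Rightarrow> complex" where
  "lin_trace s f =
     (let B = vector_space.extend_basis s {} in \<Sum>b\<in>B. module.representation s B (f b) b)"

subsection \<open>Bialgebras with a basis, and their comodules\<close>

text \<open>
  Structure constants: \<open>b\<^sub>i b\<^sub>j = \<Sum>\<^sub>k prodc i j k b\<^sub>k\<close>, \<open>1 = \<Sum>\<^sub>k unitc k b\<^sub>k\<close>,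
  \<open>\<Delta> b\<^sub>i = \<Sum>\<^sub>j\<^sub>k coprodc i (j, k) b\<^sub>j \<otimes> b\<^sub>k\<close>, \<open>\<epsilon> b\<^sub>i = counitc i\<close>.
\<close>

record 'i bialg =
  basis :: "'i set"
  prodc :: "'i \<Rightarrow> 'i \<Rightarrow> 'i \<Rightarrow> complex"
  unitc :: "'i \<Rightarrow> complex"
  coprodc :: "'i \<Rightarrow> 'i \<times> 'i \<Rightarrow> complex"
  counitc :: "'i \<Rightarrow> complex"

text \<open>
  \<open>co w = \<Sum>\<^sub>i co w i \<otimes> b\<^sub>i\<close>.  The last two conjuncts are
  \<open>(co \<otimes> id) co = (id \<otimes> \<Delta>) co\<close> and \<open>(id \<otimes> \<epsilon>) co = id\<close>.
\<close>

definition right_comodule ::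
  "(complex \<Rightarrow> 'w::ab_group_add \<Rightarrow> 'w) \<Rightarrow> ('i, 'z) bialg_scheme \<Rightarrow> ('w \<Rightarrow> 'i \<Rightarrow> 'w) \<Rightarrow> bool" where
  "right_comodule s A co \<longleftrightarrow>
     vector_space s \<and>
     (\<forall>i. Vector_Spaces.linear s s (\<lambda>w. co w i)) \<and>
     (\<forall>w i. i \<notin> basis A \<longrightarrow> co w i = 0) \<and>
     (\<forall>w. \<forall>j\<in>basis A. \<forall>k\<in>basis A.
        co (co w k) j = (\<Sum>i\<in>basis A. s (coprodc A i (j, k)) (co w i))) \<and>
     (\<forall>w. (\<Sum>i\<in>basis A. s (counitc A i) (co w i)) = w)"

definition right_comodule_hom ::
  "('i, 'z) bialg_scheme \<Rightarrow>
   (complex \<Rightarrow> 'v::ab_group_add \<Rightarrow> 'v) \<Rightarrow> ('v \<Rightarrow> 'i \<Rightarrow> 'v) \<Rightarrow>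
   (complex \<Rightarrow> 'w::ab_group_add \<Rightarrow> 'w) \<Rightarrow> ('w \<Rightarrow> 'i \<Rightarrow> 'w) \<Rightarrow> ('v \<Rightarrow> 'w) \<Rightarrow> bool" where
  "right_comodule_hom A sV coV sW coW f \<longleftrightarrow>
     Vector_Spaces.linear sV sW f \<and> (\<forall>v. \<forall>i\<in>basis A. coW (f v) i = f (coV v i))"

text \<open>
  Left comodules, on a subspace \<open>M\<close> of the ambient space: \<open>co x = \<Sum>\<^sub>i b\<^sub>i \<otimes> co x i\<close>, with
  \<open>(id \<otimes> co) co = (\<Delta> \<otimes> id) co\<close> and \<open>(\<epsilon> \<otimes> id) co = id\<close>.
\<close>

definition left_comodule ::
  "('i, 'z) bialg_scheme \<Rightarrow> (complex \<Rightarrow> 'm::ab_group_add \<Rightarrow> 'm) \<Rightarrow> 'm set \<Rightarrow> ('m \<Rightarrow> 'i \<Rightarrow> 'm) \<Rightarrow> bool"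
  where
  "left_comodule A s M co \<longleftrightarrow>
     vector_space s \<and> module.subspace s M \<and>
     (\<forall>i. linear_map_on s M s M (\<lambda>x. co x i)) \<and>
     (\<forall>x\<in>M. \<forall>i. i \<notin> basis A \<longrightarrow> co x i = 0) \<and>
     (\<forall>x\<in>M. \<forall>j\<in>basis A. \<forall>k\<in>basis A.
        co (co x j) k = (\<Sum>i\<in>basis A. s (coprodc A i (j, k)) (co x i))) \<and>
     (\<forall>x\<in>M. (\<Sum>i\<in>basis A. s (counitc A i) (co x i)) = x)"

definition left_comodule_hom ::
  "('i, 'z) bialg_scheme \<Rightarrow>
   (complex \<Rightarrow> 'm::ab_group_add \<Rightarrow> 'm) \<Rightarrow> 'm set \<Rightarrow> ('m \<Rightarrow> 'i \<Rightarrow> 'm) \<Rightarrow>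
   (complex \<Rightarrow> 'n::ab_group_add \<Rightarrow> 'n) \<Rightarrow> 'n set \<Rightarrow> ('n \<Rightarrow> 'i \<Rightarrow> 'n) \<Rightarrow> ('m \<Rightarrow> 'n) \<Rightarrow> bool" where
  "left_comodule_hom A sM M coM sN N coN f \<longleftrightarrow>
     linear_map_on sM M sN N f \<and> (\<forall>x\<in>M. \<forall>i\<in>basis A. coN (f x) i = f (coM x i))"

definition left_comodule_isomorphic ::
  "('i, 'z) bialg_scheme \<Rightarrow>
   (complex \<Rightarrow> 'm::ab_group_add \<Rightarrow> 'm) \<Rightarrow> 'm set \<Rightarrow> ('m \<Rightarrow> 'i \<Rightarrow> 'm) \<Rightarrow>
   (complex \<Rightarrow> 'n::ab_group_add \<Rightarrow> 'n) \<Rightarrow> 'n set \<Rightarrow> ('n \<Rightarrow> 'i \<Rightarrow> 'n) \<Rightarrow> bool" where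
  "left_comodule_isomorphic A sM M coM sN N coN \<longleftrightarrow>
     left_comodule A sM M coM \<and> left_comodule A sN N coN \<and>
     (\<exists>f. left_comodule_hom A sM M coM sN N coN f \<and> bij_betw f M N)"

subsection \<open>Groups and representations\<close>

definition conj_class :: "('g, 'z) monoid_scheme \<Rightarrow> 'g \<Rightarrow> 'g set" where
  "conj_class G g = {h \<otimes>\<^bsub>G\<^esub> g \<otimes>\<^bsub>G\<^esub> inv\<^bsub>G\<^esub> h | h. h \<in> carrier G}"

definition conj_classes :: "('g, 'z) monoid_scheme \<Rightarrow> 'g set set" where
  "conj_classes G = conj_class G ` carrier G"

definition centraliser :: "('g, 'z) monoid_scheme \<Rightarrow> 'g \<Rightarrow> 'g set" where
  "centraliser G r = {g \<in> carrier G. g \<otimes>\<^bsub>G\<^esub> r = r \<otimes>\<^bsub>G\<^esub> g}"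

definition is_rep ::
  "('g, 'z) monoid_scheme \<Rightarrow> 'g set \<Rightarrow> (complex \<Rightarrow> 'v::ab_group_add \<Rightarrow> 'v) \<Rightarrow> ('g \<Rightarrow> 'v \<Rightarrow> 'v) \<Rightarrow> bool"
  where
  "is_rep G K s \<pi> \<longleftrightarrow>
     vector_space s \<and>
     (\<forall>g\<in>K. Vector_Spaces.linear s s (\<pi> g)) \<and>
     \<pi> \<one>\<^bsub>G\<^esub> = id \<and>
     (\<forall>g\<in>K. \<forall>h\<in>K. \<pi> (g \<otimes>\<^bsub>G\<^esub> h) = \<pi> g \<circ> \<pi> h)"

definition irreducible_rep ::
  "('g, 'z) monoid_scheme \<Rightarrow> 'g set \<Rightarrow> (complex \<Rightarrow> 'v::ab_group_add \<Rightarrow> 'v) \<Rightarrow> ('g \<Rightarrow> 'v \<Rightarrow> 'v) \<Rightarrow> bool"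
  where
  "irreducible_rep G K s \<pi> \<longleftrightarrow>
     is_rep G K s \<pi> \<and> (\<exists>v::'v. v \<noteq> 0) \<and>
     (\<forall>U. module.subspace s U \<and> (\<forall>g\<in>K. \<pi> g ` U \<subseteq> U) \<longrightarrow> U = {0} \<or> U = UNIV)"

subsection \<open>The quantum groups\<close>

text \<open>
  The bialgebra on \<open>\<complex>(K) \<otimes> \<complex>G\<close> for a subgroup \<open>K\<close>, with \<open>(g, h)\<close> standing for the basis
  element \<open>\<delta>\<^sub>g \<otimes> h\<close>.  For \<open>K = G\<close> it is \<open>D\<^sup>\<or>(G)\<close>; for \<open>K = C\<^sub>G\<close> it is the quotient \<open>H\<close>, whose
  structure is the image of that of \<open>D\<^sup>\<or>(G)\<close> under \<open>p\<close>.
\<close>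

definition codouble :: "('g, 'z) monoid_scheme \<Rightarrow> 'g set \<Rightarrow> ('g \<times> 'g) bialg" where
  "codouble G K = \<lparr>
     basis = K \<times> carrier G,
     prodc = (\<lambda>(g, h) (u, v) p. of_bool (g = u \<and> p = (g, h \<otimes>\<^bsub>G\<^esub> v))),
     unitc = (\<lambda>(g, h). of_bool (g \<in> K \<and> h = \<one>\<^bsub>G\<^esub>)),
     coprodc = (\<lambda>(g, h) p. \<Sum>f\<in>K. of_bool (p =
        ((f, inv\<^bsub>G\<^esub> f \<otimes>\<^bsub>G\<^esub> g \<otimes>\<^bsub>G\<^esub> h \<otimes>\<^bsub>G\<^esub> inv\<^bsub>G\<^esub> g \<otimes>\<^bsub>G\<^esub> f), (inv\<^bsub>G\<^esub> f \<otimes>\<^bsub>G\<^esub> g, h)))),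
     counitc = (\<lambda>(g, h). of_bool (g = \<one>\<^bsub>G\<^esub>)) \<rparr>"

abbreviation Dvee :: "('g, 'z) monoid_scheme \<Rightarrow> ('g \<times> 'g) bialg" where
  "Dvee G \<equiv> codouble G (carrier G)"

abbreviation Hquot :: "('g, 'z) monoid_scheme \<Rightarrow> 'g \<Rightarrow> ('g \<times> 'g) bialg" where
  "Hquot G r \<equiv> codouble G (centraliser G r)"

text \<open>\<open>id \<otimes> p : M \<otimes> D\<^sup>\<or>(G) \<rightarrow> M \<otimes> H\<close>, and the pushout of a coaction.\<close>

definition proj_p :: "('g, 'z) monoid_scheme \<Rightarrow> 'g \<Rightarrow> ('g \<times> 'g \<Rightarrow> 'm::zero) \<Rightarrow> ('g \<times> 'g \<Rightarrow> 'm)" where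
  "proj_p G r x = (\<lambda>(g, h). if g \<in> centraliser G r then x (g, h) else 0)"

definition pushout ::
  "('g, 'z) monoid_scheme \<Rightarrow> 'g \<Rightarrow> ('w \<Rightarrow> 'g \<times> 'g \<Rightarrow> 'w::zero) \<Rightarrow> ('w \<Rightarrow> 'g \<times> 'g \<Rightarrow> 'w)" where
  "pushout G r co w = proj_p G r (co w)"

definition V_coact ::
  "('g, 'z) monoid_scheme \<Rightarrow> 'g \<Rightarrow> ('g \<Rightarrow> 'v \<Rightarrow> 'v::zero) \<Rightarrow> 'v \<Rightarrow> 'g \<times> 'g \<Rightarrow> 'v" where
  "V_coact G r \<pi> v = (\<lambda>(g, h). if g \<in> centraliser G r \<and> h = r then \<pi> g v else 0)"

subsection \<open>The bundle of invariants\<close>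

text \<open>
  \<open>X = \<Sum>\<^sub>i b\<^sub>i \<otimes> X i\<close> in \<open>D\<^sup>\<or>(G) \<otimes> V\<close> goes to
  \<open>\<Sum> b\<^sub>i\<^sub>(\<^sub>1\<^sub>) \<otimes> (X i)\<^sub>(\<^sub>0\<^sub>) \<otimes> p(b\<^sub>i\<^sub>(\<^sub>2\<^sub>)) (X i)\<^sub>(\<^sub>1\<^sub>)\<close>; below is its component along the basis element \<open>m\<close> of \<open>H\<close>.
\<close>

definition tensor_coact ::
  "('g, 'z) monoid_scheme \<Rightarrow> 'g \<Rightarrow> (complex \<Rightarrow> 'v::ab_group_add \<Rightarrow> 'v) \<Rightarrow> ('v \<Rightarrow> 'g \<times> 'g \<Rightarrow> 'v) \<Rightarrow>
   ('g \<times> 'g \<Rightarrow> 'v) \<Rightarrow> 'g \<times> 'g \<Rightarrow> ('g \<times> 'g \<Rightarrow> 'v)" where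
  "tensor_coact G r s coV X m =
     (\<lambda>k. \<Sum>i\<in>basis (Dvee G). \<Sum>j\<in>basis (Hquot G r). \<Sum>l\<in>basis (Hquot G r).
        s (proj_p G r (\<lambda>j'. coprodc (Dvee G) i (k, j')) j * prodc (Hquot G r) j l m) (coV (X i) l))"

definition E_space ::
  "('g, 'z) monoid_scheme \<Rightarrow> 'g \<Rightarrow> (complex \<Rightarrow> 'v::ab_group_add \<Rightarrow> 'v) \<Rightarrow> ('g \<Rightarrow> 'v \<Rightarrow> 'v) \<Rightarrow>
   ('g \<times> 'g \<Rightarrow> 'v) set" where
  "E_space G r s \<pi> =
     {X. (\<forall>i. i \<notin> basis (Dvee G) \<longrightarrow> X i = 0) \<and>
         (\<forall>k\<in>basis (Dvee G). \<forall>m\<in>basis (Hquot G r).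
            tensor_coact G r s (V_coact G r \<pi>) X m k = s (unitc (Hquot G r) m) (X k))}"

definition E_coact ::
  "('g, 'z) monoid_scheme \<Rightarrow> (complex \<Rightarrow> 'v::ab_group_add \<Rightarrow> 'v) \<Rightarrow>
   ('g \<times> 'g \<Rightarrow> 'v) \<Rightarrow> 'g \<times> 'g \<Rightarrow> ('g \<times> 'g \<Rightarrow> 'v)" where
  "E_coact G s X j =
     (\<lambda>k. if j \<in> basis (Dvee G) \<and> k \<in> basis (Dvee G)
          then \<Sum>i\<in>basis (Dvee G). s (coprodc (Dvee G) i (j, k)) (X i) else 0)"

subsection \<open>Crossed modules and the action of \<open>D(G)\<close>\<close>

text \<open>
  The \<open>G\<close>-action and the grading of a right \<open>D\<^sup>\<or>(G)\<close>-comodule, read off from its coaction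
  \<open>w \<mapsto> \<Sum>\<^sub>g g \<triangleright> w \<otimes> \<delta>\<^sub>g \<otimes> |w|\<close>: \<open>cm_comp\<close> gives the component of \<open>w\<close> of degree \<open>k\<close>.
\<close>

definition cm_act ::
  "('g, 'z) monoid_scheme \<Rightarrow> ('w \<Rightarrow> 'g \<times> 'g \<Rightarrow> 'w::comm_monoid_add) \<Rightarrow> 'g \<Rightarrow> 'w \<Rightarrow> 'w" where
  "cm_act G co g w = (\<Sum>k\<in>carrier G. co w (g, k))"

definition cm_comp ::
  "('g, 'z) monoid_scheme \<Rightarrow> ('w \<Rightarrow> 'g \<times> 'g \<Rightarrow> 'w) \<Rightarrow> 'g \<Rightarrow> 'w \<Rightarrow> 'w" where
  "cm_comp G co k w = co w (\<one>\<^bsub>G\<^esub>, k)"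

lemma coaction_iterate:
  fixes G (structure)
  assumes "group G" "finite (carrier G)" "right_comodule s (Dvee G) co"
    and "a \<in> carrier G" "b \<in> carrier G" "c \<in> carrier G" "d \<in> carrier G"
  shows "co (co w (c, d)) (a, b) = (if b = c \<otimes> d \<otimes> inv c then co w (a \<otimes> c, d) else 0)"
proof -
  interpret group G by fact
  interpret vector_space s using assms(3) by (simp add: right_comodule_def)
  have cop: "coprodc (Dvee G) (g, h) ((a, b), (c, d)) =
      of_bool ((g, h) = (a \<otimes> c, d) \<and> b = c \<otimes> d \<otimes> inv c)"
    if "g \<in> carrier G" "h \<in> carrier G" for g h
  proof -
    have "coprodc (Dvee G) (g, h) ((a, b), (c, d)) = (\<Sum>f\<in>carrier G. of_bool
        (((a, b), (c, d)) = ((f, inv f \<otimes> g \<otimes> h \<otimes> inv g \<otimes> f), (inv f \<otimes> g, h))))"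
      by (simp add: codouble_def del: prod.inject)
    also have "\<dots> =
        (\<Sum>f\<in>carrier G. if f = a then of_bool (b = inv a \<otimes> g \<otimes> h \<otimes> inv g \<otimes> a \<and> c = inv a \<otimes> g \<and> d = h) else 0)"
      by (rule sum.cong) auto
    also have "\<dots> = of_bool (b = inv a \<otimes> g \<otimes> h \<otimes> inv g \<otimes> a \<and> c = inv a \<otimes> g \<and> d = h)"
      using assms by simp
    also have "c = inv a \<otimes> g \<longleftrightarrow> g = a \<otimes> c"
      using assms that by (metis inv_solve_left)
    finally show ?thesis
      using assms that by (auto simp: inv_mult_group m_assoc inv_solve_left)
  qed
  have "co (co w (c, d)) (a, b) =
      (\<Sum>i\<in>carrier G \<times> carrier G. s (coprodc (Dvee G) i ((a, b), (c, d))) (co w i))"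
    using assms by (simp add: right_comodule_def codouble_def)
  also have "\<dots> = (\<Sum>i\<in>carrier G \<times> carrier G.
      if i = (a \<otimes> c, d) then (if b = c \<otimes> d \<otimes> inv c then co w (a \<otimes> c, d) else 0) else 0)"
  proof (rule sum.cong, goal_cases)
    case (2 i)
    then obtain g h where "i = (g, h)" "g \<in> carrier G" "h \<in> carrier G" by blast
    then show ?case using cop[of g h] by (cases "b = c \<otimes> d \<otimes> inv c") simp_all
  qed simp
  finally show ?thesis using assms by simp
qed

lemma coaction_eq:
  fixes G (structure)
  assumes "group G" "finite (carrier G)" "right_comodule s (Dvee G) co"
    and "g \<in> carrier G" "k \<in> carrier G"
  shows "co w (g, k) = cm_act G co g (cm_comp G co k w)"
proof -
  interpret group G by fact
  show ?thesis
    using assms by (simp add: cm_act_def cm_comp_def coaction_iterate[OF assms(1-3)] sum.delta)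
qed

text \<open>\<open>D(G)\<close>, with product \<open>(\<delta>\<^sub>g \<otimes> h)(\<delta>\<^sub>u \<otimes> v) = \<delta>\<^bsub>g,huh\<inverse>\<^esub> \<delta>\<^sub>g \<otimes> hv\<close>; the group element \<open>q\<close> is \<open>1 \<otimes> q\<close>.\<close>

definition dbl_mult ::
  "('g, 'z) monoid_scheme \<Rightarrow> ('g \<times> 'g \<Rightarrow> complex) \<Rightarrow> ('g \<times> 'g \<Rightarrow> complex) \<Rightarrow> ('g \<times> 'g \<Rightarrow> complex)" where
  "dbl_mult G x y = (\<lambda>p. \<Sum>(g, h)\<in>carrier G \<times> carrier G. \<Sum>(u, v)\<in>carrier G \<times> carrier G.
     if g = h \<otimes>\<^bsub>G\<^esub> u \<otimes>\<^bsub>G\<^esub> inv\<^bsub>G\<^esub> h \<and> p = (g, h \<otimes>\<^bsub>G\<^esub> v) then x (g, h) * y (u, v) else 0)"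

definition dbl_grp :: "('g, 'z) monoid_scheme \<Rightarrow> 'g \<Rightarrow> ('g \<times> 'g \<Rightarrow> complex)" where
  "dbl_grp G q = (\<lambda>(g, h). of_bool (g \<in> carrier G \<and> h = q))"

text \<open>\<open>(\<delta>\<^sub>g \<otimes> h) \<triangleright> w = \<delta>\<^bsub>g,h|w|h\<inverse>\<^esub> h \<triangleright> w\<close>, summing over the homogeneous components of \<open>w\<close>.\<close>

definition dbl_act ::
  "('g, 'z) monoid_scheme \<Rightarrow> (complex \<Rightarrow> 'w::ab_group_add \<Rightarrow> 'w) \<Rightarrow> ('w \<Rightarrow> 'g \<times> 'g \<Rightarrow> 'w) \<Rightarrow>
   ('g \<times> 'g \<Rightarrow> complex) \<Rightarrow> 'w \<Rightarrow> 'w" where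
  "dbl_act G s co x w = (\<Sum>(g, h)\<in>carrier G \<times> carrier G. \<Sum>k\<in>carrier G.
     if g = h \<otimes>\<^bsub>G\<^esub> k \<otimes>\<^bsub>G\<^esub> inv\<^bsub>G\<^esub> h then s (x (g, h)) (cm_act G co h (cm_comp G co k w)) else 0)"

definition P_rpi ::
  "('g, 'z) monoid_scheme \<Rightarrow> 'g \<Rightarrow> (complex \<Rightarrow> 'v::ab_group_add \<Rightarrow> 'v) \<Rightarrow> ('g \<Rightarrow> 'v \<Rightarrow> 'v) \<Rightarrow>
   ('g \<times> 'g \<Rightarrow> complex)" where
  "P_rpi G r s \<pi> = (\<lambda>(g, n).
     if g = r \<and> n \<in> centraliser G r
     then of_nat (vector_space.dim s (UNIV :: 'v set)) / of_nat (card (centraliser G r)) *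
          lin_trace s (\<pi> (inv\<^bsub>G\<^esub> n))
     else 0)"

subsection \<open>Sections: \<open>\<complex>G \<otimes> W\<close>\<close>

definition CGW :: "('g, 'z) monoid_scheme \<Rightarrow> ('g \<Rightarrow> 'w::zero) set" where
  "CGW G = {t. \<forall>g. g \<notin> carrier G \<longrightarrow> t g = 0}"

text \<open>\<open>g \<otimes> w \<mapsto> \<Sum>\<^sub>f \<delta>\<^sub>f \<otimes> f\<inverse>gf \<otimes> f\<inverse>gf \<otimes> f\<inverse> \<triangleright> w\<close>; the component along \<open>\<delta>\<^sub>f \<otimes> k\<close>.\<close>

definition CGW_coact ::
  "('g, 'z) monoid_scheme \<Rightarrow> ('g \<Rightarrow> 'w \<Rightarrow> 'w) \<Rightarrow> ('g \<Rightarrow> 'w::comm_monoid_add) \<Rightarrow> 'g \<times> 'g \<Rightarrow> ('g \<Rightarrow> 'w)" where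
  "CGW_coact G act t = (\<lambda>(f, k) x. \<Sum>g\<in>carrier G.
     if f \<in> carrier G \<and> k = inv\<^bsub>G\<^esub> f \<otimes>\<^bsub>G\<^esub> g \<otimes>\<^bsub>G\<^esub> f \<and> x = inv\<^bsub>G\<^esub> f \<otimes>\<^bsub>G\<^esub> g \<otimes>\<^bsub>G\<^esub> f
     then act (inv\<^bsub>G\<^esub> f) (t g) else 0)"

definition gelt :: "'g \<Rightarrow> 'g \<Rightarrow> complex" where
  "gelt g = (\<lambda>x. of_bool (x = g))"

text \<open>\<open>T \<otimes> id\<^sub>W\<close> for a linear operator \<open>T\<close> on \<open>\<complex>G\<close>.\<close>

definition op_tensor_id ::
  "('g, 'z) monoid_scheme \<Rightarrow> (complex \<Rightarrow> 'w::ab_group_add \<Rightarrow> 'w) \<Rightarrow>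
   (('g \<Rightarrow> complex) \<Rightarrow> ('g \<Rightarrow> complex)) \<Rightarrow> ('g \<Rightarrow> 'w) \<Rightarrow> ('g \<Rightarrow> 'w)" where
  "op_tensor_id G s T t = (\<lambda>x. \<Sum>g\<in>carrier G. s (T (gelt g) x) (t g))"

text \<open>\<open>\<complex>G\<close> is the case \<open>W = \<complex>\<close> with trivial action.\<close>

definition covariant_op ::
  "('g, 'z) monoid_scheme \<Rightarrow> (('g \<Rightarrow> complex) \<Rightarrow> ('g \<Rightarrow> complex)) \<Rightarrow> bool" where
  "covariant_op G T \<longleftrightarrow>
     left_comodule_hom (Dvee G)
       (fscale (*)) (CGW G) (CGW_coact G (\<lambda>_ w. w))
       (fscale (*)) (CGW G) (CGW_coact G (\<lambda>_ w. w)) T"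

definition CG_star :: "('g, 'z) monoid_scheme \<Rightarrow> ('g \<Rightarrow> complex) \<Rightarrow> ('g \<Rightarrow> complex)" where
  "CG_star G x = (\<lambda>y. \<Sum>g\<in>carrier G. cnj (x g) * gelt (inv\<^bsub>G\<^esub> g) y)"

definition star_compatible ::
  "('g, 'z) monoid_scheme \<Rightarrow> (('g \<Rightarrow> complex) \<Rightarrow> ('g \<Rightarrow> complex)) \<Rightarrow> bool" where
  "star_compatible G T \<longleftrightarrow> (\<forall>x\<in>CGW G. T (CG_star G x) = CG_star G (T x))"

definition has_class_eigenvalues ::
  "('g, 'z) monoid_scheme \<Rightarrow> (('g \<Rightarrow> complex) \<Rightarrow> ('g \<Rightarrow> complex)) \<Rightarrow> ('g set \<Rightarrow> complex) \<Rightarrow> bool" where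
  "has_class_eigenvalues G T lam \<longleftrightarrow>
     (\<forall>g\<in>carrier G. T (gelt g) = fscale (*) (lam (conj_class G g)) (gelt g))"

definition regular_eigenvalues :: "('g, 'z) monoid_scheme \<Rightarrow> ('g set \<Rightarrow> complex) \<Rightarrow> bool" where
  "regular_eigenvalues G lam \<longleftrightarrow>
     (\<forall>D\<in>conj_classes G. lam D \<in> \<real> \<and> lam D = lam (set_inv\<^bsub>G\<^esub> D)) \<and>
     lam {\<one>\<^bsub>G\<^esub>} = 0 \<and>
     (\<forall>D\<in>conj_classes G. \<forall>D'\<in>conj_classes G.
        lam D = lam D' \<longrightarrow> D' = D \<or> D' = set_inv\<^bsub>G\<^esub> D)"

text \<open>
  \<open>q\<close> is the given map on the class \<open>C\<close>.  \<open>Q\<close> is the family \<open>g \<mapsto> q\<^sub>g\<close> on the whole of \<open>G\<close> used to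
  extend \<open>P\<^sup>cov\<close>, relative to representatives \<open>rep D\<close> of the classes.  As \<open>P\<^sup>cov\<close> on \<open>\<complex>C\<inverse> \<otimes> W\<close>
  uses \<open>q\<^sub>c\<close> over \<open>c\<inverse>\<close>, we need \<open>Q (c\<inverse>) = q c\<close>; this forces \<open>rep (C\<inverse>) = r\<inverse>\<close>.
\<close>

definition q_section :: "('g, 'z) monoid_scheme \<Rightarrow> 'g set \<Rightarrow> 'g \<Rightarrow> ('g \<Rightarrow> 'g) \<Rightarrow> bool" where
  "q_section G C r q \<longleftrightarrow>
     (\<forall>c\<in>C. q c \<in> carrier G \<and> q c \<otimes>\<^bsub>G\<^esub> r \<otimes>\<^bsub>G\<^esub> inv\<^bsub>G\<^esub> (q c) = c) \<and> q r = \<one>\<^bsub>G\<^esub>"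

definition q_extension ::
  "('g, 'z) monoid_scheme \<Rightarrow> 'g set \<Rightarrow> ('g \<Rightarrow> 'g) \<Rightarrow> ('g set \<Rightarrow> 'g) \<Rightarrow> ('g \<Rightarrow> 'g) \<Rightarrow> bool" where
  "q_extension G C q rep Q \<longleftrightarrow>
     (\<forall>D\<in>conj_classes G. rep D \<in> D) \<and>
     (\<forall>g\<in>carrier G. Q g \<in> carrier G \<and>
        Q g \<otimes>\<^bsub>G\<^esub> rep (conj_class G g) \<otimes>\<^bsub>G\<^esub> inv\<^bsub>G\<^esub> (Q g) = g) \<and>
     (\<forall>c\<in>C. Q (inv\<^bsub>G\<^esub> c) = q c)"

definition P_cov ::
  "('g, 'z) monoid_scheme \<Rightarrow> (complex \<Rightarrow> 'w::ab_group_add \<Rightarrow> 'w) \<Rightarrow> ('w \<Rightarrow> 'g \<times> 'g \<Rightarrow> 'w) \<Rightarrow>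
   ('g \<times> 'g \<Rightarrow> complex) \<Rightarrow> ('g \<Rightarrow> 'g) \<Rightarrow> ('g \<Rightarrow> 'w) \<Rightarrow> ('g \<Rightarrow> 'w)" where
  "P_cov G s co P Q t = (\<lambda>g. if g \<in> carrier G
     then dbl_act G s co
            (dbl_mult G (dbl_mult G (dbl_grp G (Q g)) P) (dbl_grp G (inv\<^bsub>G\<^esub> (Q g)))) (t g)
     else 0)"

definition solution_space ::
  "('g, 'z) monoid_scheme \<Rightarrow> (complex \<Rightarrow> 'w::ab_group_add \<Rightarrow> 'w) \<Rightarrow> ('w \<Rightarrow> 'g \<times> 'g \<Rightarrow> 'w) \<Rightarrow>
   (('g \<Rightarrow> complex) \<Rightarrow> ('g \<Rightarrow> complex)) \<Rightarrow> complex \<Rightarrow> ('g \<times> 'g \<Rightarrow> complex) \<Rightarrow> ('g \<Rightarrow> 'g) \<Rightarrow>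
   ('g \<Rightarrow> 'w) set" where
  "solution_space G s co box l P Q =
     {t \<in> CGW G. op_tensor_id G s (\<lambda>x. box x - fscale (*) l x) t = 0 \<and> P_cov G s co P Q t = t}"

end

theory Submission
  imports Defs
begin

text \<open>
  An element of \<open>E\<close> is a function \<open>X : G \<rightarrow> V\<^sub>\<pi>\<close> (times \<open>r\<inverse>\<close> in the second leg) with
  \<open>\<pi>(n) X(fn) = X(f)\<close> for \<open>n \<in> C\<^sub>G\<close>.  With \<open>\<iota> : V\<^sub>r\<^sub>,\<^sub>\<pi> \<rightarrow> W\<close> the embedding of \<open>H\<close>-comodules, the
  isomorphism sends \<open>X\<close> to the section with value \<open>f \<triangleright> \<iota>(X(f))\<close> at \<open>f r\<inverse> f\<inverse>\<close>.  Its image is cut out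
  by \<open>P\<^sup>c\<^sup>o\<^sup>v\<close>, since \<open>P\<^sub>r\<^sub>,\<^sub>\<pi>\<close> is a projection of \<open>W\<close> onto \<open>\<iota>(V\<^sub>\<pi>)\<close>.  The comodule axioms for the solution
  space are transported along this map, and a regular Laplacian restricts supports to \<open>C \<union> C\<inverse>\<close>, which
  is \<open>C\<inverse>\<close> when \<open>C\<close> is closed under inversion.
\<close>

section \<open>Conjugation, centralisers and classes in a finite group\<close>

locale finite_group = group G for G (structure) +
  assumes fin: "finite (carrier G)"
begin

lemma conj_conj:
  "a \<in> carrier G \<Longrightarrow> b \<in> carrier G \<Longrightarrow> x \<in> carrier G \<Longrightarrow>
    a \<otimes> (b \<otimes> x \<otimes> inv b) \<otimes> inv a = (a \<otimes> b) \<otimes> x \<otimes> inv (a \<otimes> b)"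
  by (simp add: inv_mult_group m_assoc)

lemma conj_eq_iff:
  "g \<in> carrier G \<Longrightarrow> x \<in> carrier G \<Longrightarrow> y \<in> carrier G \<Longrightarrow>
    x = g \<otimes> y \<otimes> inv g \<longleftrightarrow> inv g \<otimes> x \<otimes> g = y"
  by (metis inv_closed inv_solve_left inv_solve_right m_assoc m_closed)

lemma bij_betw_conj:
  assumes "g \<in> carrier G"
  shows "bij_betw (\<lambda>x. inv g \<otimes> x \<otimes> g) (carrier G) (carrier G)"
  by (rule bij_betwI[where g = "\<lambda>x. g \<otimes> x \<otimes> inv g"])
     (use assms conj_eq_iff in \<open>auto, (metis inv_closed m_closed)+\<close>)

lemma inv_conj:
  "g \<in> carrier G \<Longrightarrow> x \<in> carrier G \<Longrightarrow> inv (g \<otimes> x \<otimes> inv g) = g \<otimes> inv x \<otimes> inv g"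
  by (simp add: inv_mult_group m_assoc)

lemma centraliser_iff:
  "r \<in> carrier G \<Longrightarrow> g \<in> centraliser G r \<longleftrightarrow> g \<in> carrier G \<and> g \<otimes> r \<otimes> inv g = r"
  using inv_solve_right[of r "g \<otimes> r" g] by (auto simp: centraliser_def)

lemma centraliser_subset: "centraliser G r \<subseteq> carrier G"
  by (auto simp: centraliser_def)

lemma centraliser_one: "r \<in> carrier G \<Longrightarrow> \<one> \<in> centraliser G r"
  by (simp add: centraliser_def)

lemma centraliser_mult:
  "r \<in> carrier G \<Longrightarrow> g \<in> centraliser G r \<Longrightarrow> h \<in> centraliser G r \<Longrightarrow> g \<otimes> h \<in> centraliser G r"
  by (simp add: centraliser_iff flip: conj_conj)

lemma centraliser_inv:
  "r \<in> carrier G \<Longrightarrow> g \<in> centraliser G r \<Longrightarrow> inv g \<in> centraliser G r"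
  by (metis centraliser_iff conj_eq_iff inv_closed inv_inv)

lemma centraliser_conj_inv:
  "r \<in> carrier G \<Longrightarrow> g \<in> centraliser G r \<Longrightarrow> g \<otimes> inv r \<otimes> inv g = inv r"
  by (metis centraliser_iff inv_conj)

lemma conj_class_eq:
  assumes "g \<in> carrier G" "h \<in> conj_class G g"
  shows "conj_class G h = conj_class G g"
proof -
  obtain x where x: "x \<in> carrier G" "h = x \<otimes> g \<otimes> inv x"
    using assms by (auto simp: conj_class_def)
  have g: "g = inv x \<otimes> h \<otimes> inv (inv x)"
    using x assms conj_eq_iff[of x h g] by simp
  have h: "h \<in> carrier G"
    using x assms by simp
  show ?thesis
  proof (intro equalityI subsetI)
    fix k assume "k \<in> conj_class G h"
    then obtain y where y: "y \<in> carrier G" "k = y \<otimes> h \<otimes> inv y"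
      by (auto simp: conj_class_def)
    then have "k = (y \<otimes> x) \<otimes> g \<otimes> inv (y \<otimes> x)"
      using x assms conj_conj[of y x g] by simp
    then show "k \<in> conj_class G g"
      using x y unfolding conj_class_def by blast
  next
    fix k assume "k \<in> conj_class G g"
    then obtain y where y: "y \<in> carrier G" "k = y \<otimes> g \<otimes> inv y"
      by (auto simp: conj_class_def)
    then have "k = (y \<otimes> inv x) \<otimes> h \<otimes> inv (y \<otimes> inv x)"
      using x(1) h conj_conj[of y "inv x" h] g by simp
    then show "k \<in> conj_class G h"
      using x y unfolding conj_class_def by blast
  qed
qed

lemma conj_class_self: "g \<in> carrier G \<Longrightarrow> g \<in> conj_class G g"
  by (auto simp: conj_class_def intro!: exI[of _ \<one>])

lemma conj_class_subset: "g \<in> carrier G \<Longrightarrow> conj_class G g \<subseteq> carrier G"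
  by (auto simp: conj_class_def)

lemma set_inv_conj_class:
  assumes "g \<in> carrier G"
  shows "set_inv (conj_class G g) = conj_class G (inv g)"
  using assms inv_conj by (fastforce simp: conj_class_def SET_INV_def)

text \<open>The first tensor leg forces \<open>f = a\<close> in the sum defining the coproduct, and
  the remaining equations can be solved for \<open>(g, h)\<close>. Thus a given pair of legs arises
  from at most one basis element, which collapses every later sum over coproduct
  coefficients.\<close>

lemma coprodc_Dvee:
  assumes "a \<in> carrier G" "b \<in> carrier G" "c \<in> carrier G" "d \<in> carrier G"
    "g \<in> carrier G" "h \<in> carrier G"
  shows "coprodc (Dvee G) (g, h) ((a, b), (c, d)) =
    of_bool ((g, h) = (a \<otimes> c, d) \<and> b = c \<otimes> d \<otimes> inv c)"
proof -
  have "coprodc (Dvee G) (g, h) ((a, b), (c, d)) = (\<Sum>f\<in>carrier G. of_bool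
      (((a, b), (c, d)) = ((f, inv f \<otimes> g \<otimes> h \<otimes> inv g \<otimes> f), (inv f \<otimes> g, h))))"
    by (simp add: codouble_def del: prod.inject)
  also have "\<dots> = (\<Sum>f\<in>carrier G.
      if f = a then of_bool (b = inv a \<otimes> g \<otimes> h \<otimes> inv g \<otimes> a \<and> c = inv a \<otimes> g \<and> d = h) else 0)"
    by (rule sum.cong) auto
  also have "\<dots> = of_bool (b = inv a \<otimes> g \<otimes> h \<otimes> inv g \<otimes> a \<and> c = inv a \<otimes> g \<and> d = h)"
    using assms fin by simp
  also have "c = inv a \<otimes> g \<longleftrightarrow> g = a \<otimes> c"
    using assms by (metis inv_solve_left)
  finally show ?thesis
    using assms by (auto simp: inv_mult_group m_assoc inv_solve_left)
qed

end

text \<open>Grouping the indices into a pair and a quadruple leaves a single exchange of two sums.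
  This serves the associativity of the action of \<open>D(G)\<close>.\<close>

lemma sum_swap_2_4:
  "(\<Sum>a\<in>A. \<Sum>b\<in>B. \<Sum>g\<in>C. \<Sum>h\<in>D. \<Sum>u\<in>E. \<Sum>v\<in>F. f a b g h u v) =
   (\<Sum>g\<in>C. \<Sum>h\<in>D. \<Sum>u\<in>E. \<Sum>v\<in>F. \<Sum>a\<in>A. \<Sum>b\<in>B. f a b g h u v)"
  using sum.swap[of "\<lambda>(a, b) (g, h, u, v). f a b g h u v" "C \<times> D \<times> E \<times> F" "A \<times> B"]
  by (simp only: sum.cartesian_product' prod.case)

lemma vector_space_fscale:
  assumes "vector_space s"
  shows "vector_space (fscale s)"
proof -
  interpret vector_space s by fact
  show ?thesis
    by unfold_locales
       (auto simp: fscale_def scale_right_distrib scale_left_distrib plus_fun_def)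
qed

section \<open>Crossed modules and the action of the quantum double\<close>

locale crossed_module = finite_group G for G (structure) +
  fixes sW :: "complex \<Rightarrow> 'w::ab_group_add \<Rightarrow> 'w" and coW
  assumes comod: "right_comodule sW (Dvee G) coW"
begin

sublocale W: vector_space sW
  using comod by (simp add: right_comodule_def)

lemma coW_linear: "Vector_Spaces.linear sW sW (\<lambda>w. coW w i)"
  using comod unfolding right_comodule_def by blast

lemma coW_simps:
  "coW (sW a x) i = sW a (coW x i)" "coW 0 i = 0" "coW (x + y) i = coW x i + coW y i"
  "coW (sum f A) i = (\<Sum>j\<in>A. coW (f j) i)"
proof -
  interpret co: Vector_Spaces.linear sW sW "\<lambda>w. coW w i" by (rule coW_linear)
  show "coW (sW a x) i = sW a (coW x i)" "coW 0 i = 0" "coW (x + y) i = coW x i + coW y i"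
    "coW (sum f A) i = (\<Sum>j\<in>A. coW (f j) i)"
    by (simp_all add: co.scale co.add co.sum co.zero)
qed

lemmas coW_iterate = coaction_iterate[OF group_axioms fin comod]

abbreviation act where "act \<equiv> cm_act G coW"

lemma coW_eq: "g \<in> carrier G \<Longrightarrow> k \<in> carrier G \<Longrightarrow> coW w (g, k) = act g (cm_comp G coW k w)"
  by (rule coaction_eq[OF group_axioms fin comod])

lemma act_simps:
  "act g (sW a x) = sW a (act g x)" "act g 0 = 0" "act g (x + y) = act g x + act g y"
  "act g (sum f A) = (\<Sum>j\<in>A. act g (f j))"
  unfolding cm_act_def coW_simps
  by (simp_all add: W.scale_sum_right sum.distrib sum.swap[of _ A])

text \<open>This is the crossed module condition: by coassociativity the component
  \<open>(b, l)\<close> of \<open>coW w\<close> is homogeneous of degree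
  \<open>b \<otimes> l \<otimes> inv b\<close>, so a prescribed degree \<open>k\<close> selects one
  \<open>l\<close>.\<close>

lemma coW_act:
  assumes "a \<in> carrier G" "b \<in> carrier G" "k \<in> carrier G"
  shows "coW (act b w) (a, k) = coW w (a \<otimes> b, inv b \<otimes> k \<otimes> b)"
proof -
  have "coW (act b w) (a, k) = (\<Sum>l\<in>carrier G. if l = inv b \<otimes> k \<otimes> b then coW w (a \<otimes> b, l) else 0)"
    unfolding cm_act_def coW_simps using assms conj_eq_iff[of b k]
    by (intro sum.cong refl) (auto simp: coW_iterate)
  then show ?thesis
    using assms fin by simp
qed

text \<open>Acting sums over all degrees, so the conjugation of degrees in \<open>coW_act\<close> is
  absorbed by reindexing.\<close>

lemma act_act:
  assumes "a \<in> carrier G" "b \<in> carrier G"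
  shows "act a (act b w) = act (a \<otimes> b) w"
  using sum.reindex_bij_betw[OF bij_betw_conj[OF assms(2)], of "\<lambda>k. coW w (a \<otimes> b, k)"] assms
  by (simp add: cm_act_def[of G coW a] cm_act_def[of G coW "a \<otimes> b"] coW_act)

lemma act_one: "act \<one> w = w"
proof -
  have "w = (\<Sum>i\<in>basis (Dvee G). sW (counitc (Dvee G) i) (coW w i))"
    using comod unfolding right_comodule_def by simp
  also have "\<dots> = (\<Sum>g\<in>carrier G. \<Sum>k\<in>carrier G. sW (of_bool (g = \<one>)) (coW w (g, k)))"
    by (simp add: codouble_def sum.cartesian_product case_prod_unfold)
  also have "\<dots> = (\<Sum>g\<in>carrier G. if g = \<one> then (\<Sum>k\<in>carrier G. coW w (g, k)) else 0)"
    by (intro sum.cong) auto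
  also have "\<dots> = act \<one> w"
    using fin by (simp add: cm_act_def)
  finally show ?thesis by simp
qed

lemma act_inv_act: "a \<in> carrier G \<Longrightarrow> act (inv a) (act a w) = w"
  "a \<in> carrier G \<Longrightarrow> act a (act (inv a) w) = w"
  by (simp_all add: act_act act_one)

text \<open>The delta condition fixes the degree \<open>k\<close>, and acting on that homogeneous
  component gives back a coefficient of the coaction. Later computations then need only
  \<open>coW_iterate\<close>.\<close>

lemma dbl_act_eq:
  "dbl_act G sW coW x w =
    (\<Sum>g\<in>carrier G. \<Sum>h\<in>carrier G. sW (x (g, h)) (coW w (h, inv h \<otimes> g \<otimes> h)))"
proof -
  have "(\<Sum>k\<in>carrier G. if g = h \<otimes> k \<otimes> inv h then sW (x (g, h)) (act h (cm_comp G coW k w)) else 0) =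
     sW (x (g, h)) (coW w (h, inv h \<otimes> g \<otimes> h))" if "g \<in> carrier G" "h \<in> carrier G" for g h
  proof -
    have "(\<Sum>k\<in>carrier G. if g = h \<otimes> k \<otimes> inv h then sW (x (g, h)) (act h (cm_comp G coW k w)) else 0) =
      (\<Sum>k\<in>carrier G. if k = inv h \<otimes> g \<otimes> h then sW (x (g, h)) (coW w (h, k)) else 0)"
      using that conj_eq_iff[of h g] by (intro sum.cong refl) (auto simp: coW_eq)
    then show ?thesis using that fin by simp
  qed
  then show ?thesis
    by (simp add: dbl_act_def flip: sum.cartesian_product cong: sum.cong)
qed

text \<open>With this module axiom the conjugate of the projection element by \<open>Q g\<close> in
  \<open>P_cov\<close> acts as three successive operators, so that fixed sections are governed by
  one operator at \<open>r\<close>.\<close>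

lemma dbl_act_mult:
  "dbl_act G sW coW (dbl_mult G x y) w = dbl_act G sW coW x (dbl_act G sW coW y w)"
proof -
  let ?C = "carrier G"
  \<comment> \<open>For fixed \<open>g\<close>, \<open>h\<close>, \<open>u\<close>, \<open>v\<close>
    the product is supported on the single pair \<open>(g, h \<otimes> v)\<close>, and its delta
    condition is the degree condition of \<open>coW_iterate\<close>.\<close>
  have eq: "(\<Sum>a\<in>?C. \<Sum>b\<in>?C. sW (if g = h \<otimes> u \<otimes> inv h \<and> (a, b) = (g, h \<otimes> v) then c else 0)
        (coW w (b, inv b \<otimes> a \<otimes> b))) =
      sW c (coW (coW w (v, inv v \<otimes> u \<otimes> v)) (h, inv h \<otimes> g \<otimes> h))"
    if C: "g \<in> ?C" "h \<in> ?C" "u \<in> ?C" "v \<in> ?C" for g h u v c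
  proof -
    have "(\<Sum>a\<in>?C. \<Sum>b\<in>?C. sW (if g = h \<otimes> u \<otimes> inv h \<and> (a, b) = (g, h \<otimes> v) then c else 0)
        (coW w (b, inv b \<otimes> a \<otimes> b))) =
      (\<Sum>a\<in>?C. if a = g then (\<Sum>b\<in>?C. if b = h \<otimes> v then
        (if g = h \<otimes> u \<otimes> inv h then sW c (coW w (b, inv b \<otimes> a \<otimes> b)) else 0) else 0) else 0)"
      by (intro sum.cong refl) (auto intro!: sum.cong)
    also have "\<dots> = (if g = h \<otimes> u \<otimes> inv h then
        sW c (coW w (h \<otimes> v, inv (h \<otimes> v) \<otimes> g \<otimes> (h \<otimes> v))) else 0)"
      using C fin by (simp add: sum.delta)
    also have "\<dots> = sW c (coW (coW w (v, inv v \<otimes> u \<otimes> v)) (h, inv h \<otimes> g \<otimes> h))"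
    proof (cases "g = h \<otimes> u \<otimes> inv h")
      case True
      then have *: "inv h \<otimes> g \<otimes> h = u" using C conj_eq_iff by simp
      then have "inv (h \<otimes> v) \<otimes> g \<otimes> (h \<otimes> v) = inv v \<otimes> u \<otimes> v"
        using C by (simp add: inv_mult_group m_assoc flip: *)
      moreover have "u = v \<otimes> (inv v \<otimes> u \<otimes> v) \<otimes> inv v"
        using C conj_eq_iff by simp
      ultimately show ?thesis
        using C True * by (simp add: coW_iterate)
    next
      case False
      then have "inv h \<otimes> g \<otimes> h \<noteq> u" using C conj_eq_iff by blast
      moreover have "v \<otimes> (inv v \<otimes> u \<otimes> v) \<otimes> inv v = u"
        using C conj_eq_iff[of v u "inv v \<otimes> u \<otimes> v"] by simp
      ultimately show ?thesis
        using C False by (simp add: coW_iterate)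
    qed
    finally show ?thesis .
  qed
  have "dbl_act G sW coW (dbl_mult G x y) w =
    (\<Sum>a\<in>?C. \<Sum>b\<in>?C. \<Sum>g\<in>?C. \<Sum>h\<in>?C. \<Sum>u\<in>?C. \<Sum>v\<in>?C.
      sW (if g = h \<otimes> u \<otimes> inv h \<and> (a, b) = (g, h \<otimes> v) then x (g, h) * y (u, v) else 0)
        (coW w (b, inv b \<otimes> a \<otimes> b)))"
    by (simp only: dbl_act_eq dbl_mult_def W.scale_sum_left split_def sum.cartesian_product' fst_conv snd_conv)
  also have "\<dots> = (\<Sum>g\<in>?C. \<Sum>h\<in>?C. \<Sum>u\<in>?C. \<Sum>v\<in>?C. \<Sum>a\<in>?C. \<Sum>b\<in>?C.
      sW (if g = h \<otimes> u \<otimes> inv h \<and> (a, b) = (g, h \<otimes> v) then x (g, h) * y (u, v) else 0)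
        (coW w (b, inv b \<otimes> a \<otimes> b)))"
    by (rule sum_swap_2_4)
  also have "\<dots> = (\<Sum>g\<in>?C. \<Sum>h\<in>?C. \<Sum>u\<in>?C. \<Sum>v\<in>?C.
      sW (x (g, h) * y (u, v)) (coW (coW w (v, inv v \<otimes> u \<otimes> v)) (h, inv h \<otimes> g \<otimes> h)))"
    by (intro sum.cong refl eq)
  also have "\<dots> = dbl_act G sW coW x (dbl_act G sW coW y w)"
    by (simp add: dbl_act_eq coW_simps W.scale_sum_right)
  finally show ?thesis .
qed

lemma dbl_act_grp:
  assumes "a \<in> carrier G"
  shows "dbl_act G sW coW (dbl_grp G a) w = act a w"
proof -
  have "dbl_act G sW coW (dbl_grp G a) w =
    (\<Sum>g\<in>carrier G. \<Sum>h\<in>carrier G. if h = a then coW w (a, inv a \<otimes> g \<otimes> a) else 0)"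
    unfolding dbl_act_eq by (intro sum.cong refl) (auto simp: dbl_grp_def)
  also have "\<dots> = (\<Sum>g\<in>carrier G. coW w (a, inv a \<otimes> g \<otimes> a))"
    using assms fin by simp
  also have "\<dots> = act a w"
    unfolding cm_act_def
    by (rule sum.reindex_bij_betw[OF bij_betw_conj[OF assms], of "\<lambda>k. coW w (a, k)"])
  finally show ?thesis .
qed

lemma P_cov_eq:
  assumes "g \<in> carrier G" "Q g \<in> carrier G"
  shows "P_cov G sW coW P Q t g = act (Q g) (dbl_act G sW coW P (act (inv (Q g)) (t g)))"
  using assms by (simp add: P_cov_def dbl_act_mult dbl_act_grp)

text \<open>\<open>T\<close> is diagonal in the basis of group elements, so the equation decouples
  pointwise and a nonzero value is possible only where the eigenvalue is \<open>l\<close>.\<close>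

lemma op_tensor_id_class_eigenvalues:
  assumes "has_class_eigenvalues G T lam"
  shows "op_tensor_id G sW (\<lambda>x. T x - fscale (*) l x) t = 0 \<longleftrightarrow>
    (\<forall>g\<in>carrier G. lam (conj_class G g) = l \<or> t g = 0)"
proof -
  have "op_tensor_id G sW (\<lambda>x. T x - fscale (*) l x) t x =
      (if x \<in> carrier G then sW (lam (conj_class G x) - l) (t x) else 0)" for x
  proof -
    have "op_tensor_id G sW (\<lambda>x. T x - fscale (*) l x) t x =
      (\<Sum>g\<in>carrier G. if g = x then sW (lam (conj_class G x) - l) (t x) else 0)"
      unfolding op_tensor_id_def using assms
      by (intro sum.cong refl) (auto simp: has_class_eigenvalues_def fscale_def gelt_def)
    then show ?thesis using fin by simp
  qed
  then show ?thesis
    by (auto simp: fun_eq_iff)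
qed

end

section \<open>Irreducibility and the projection onto the embedded representation\<close>

lemma irreducible_rep_finite_span:
  fixes G (structure) and s :: "complex \<Rightarrow> 'v::ab_group_add \<Rightarrow> 'v"
  assumes "irreducible_rep G K s \<pi>" "finite K" "\<one> \<in> K" "\<And>g h. g \<in> K \<Longrightarrow> h \<in> K \<Longrightarrow> g \<otimes> h \<in> K"
  shows "\<exists>T. finite T \<and> module.span s T = UNIV"
proof -
  have rep: "is_rep G K s \<pi>" and ex: "\<exists>v::'v. v \<noteq> 0"
    and irr: "\<And>U. module.subspace s U \<Longrightarrow> (\<forall>g\<in>K. \<pi> g ` U \<subseteq> U) \<Longrightarrow> U = {0} \<or> U = UNIV"
    using assms(1) unfolding irreducible_rep_def by blast+
  interpret vector_space s
    using rep by (simp add: is_rep_def)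
  obtain v :: 'v where v: "v \<noteq> 0" using ex by blast
  \<comment> \<open>The orbit of a nonzero vector is finite and its span is invariant, so
    irreducibility makes it everything. Finite dimension, on which \<open>lin_trace\<close> and
    \<open>dim\<close> depend, is thus derived rather than assumed.\<close>
  define T where "T = (\<lambda>g. \<pi> g v) ` K"
  have "\<pi> g ` span T \<subseteq> span T" if g: "g \<in> K" for g
  proof -
    interpret pg: Vector_Spaces.linear s s "\<pi> g"
      using rep g by (simp add: is_rep_def)
    have "\<pi> g (\<pi> h v) = \<pi> (g \<otimes> h) v" if "h \<in> K" for h
      using rep g that by (simp add: is_rep_def)
    then have "\<pi> g ` T \<subseteq> T"
      using assms(4)[OF g] by (auto simp: T_def)
    then show ?thesis
      by (simp add: pg.span_image[symmetric] span_mono)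
  qed
  then have "span T = {0} \<or> span T = UNIV"
    by (intro irr subspace_span) blast
  moreover have "v \<in> span T"
    using rep assms(3) by (auto simp: T_def is_rep_def intro!: span_base image_eqI[of _ _ \<one>])
  ultimately show ?thesis
    using v assms(2) by (intro exI[of _ T]) (auto simp: T_def)
qed

locale comodule_embedding = crossed_module G sW coW
  for G (structure) and sW :: "complex \<Rightarrow> 'w::ab_group_add \<Rightarrow> 'w" and coW +
  fixes r and sV :: "complex \<Rightarrow> 'v::ab_group_add \<Rightarrow> 'v" and \<pi> and \<iota> :: "'v \<Rightarrow> 'w"
  assumes r: "r \<in> carrier G"
    and irr: "irreducible_rep G (centraliser G r) sV \<pi>"
    and hom: "right_comodule_hom (Hquot G r) sV (V_coact G r \<pi>) sW (pushout G r coW) \<iota>"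
    and inj: "inj \<iota>"
    and multiplicity_one: "\<And>\<phi>.
      right_comodule_hom (Hquot G r) sV (V_coact G r \<pi>) sW (pushout G r coW) \<phi> \<Longrightarrow>
      \<exists>a. \<forall>v. \<phi> v = sW a (\<iota> v)"
begin

abbreviation K where "K \<equiv> centraliser G r"

lemma rep: "is_rep G K sV \<pi>"
  using irr by (simp add: irreducible_rep_def)

sublocale V: vector_space sV
  using rep by (simp add: is_rep_def)

lemma K_carrier: "n \<in> K \<Longrightarrow> n \<in> carrier G"
  using centraliser_subset by blast

lemma finite_K: "finite K"
  using centraliser_subset fin by (rule finite_subset)

lemmas K_closed = centraliser_one[OF r] centraliser_mult[OF r] centraliser_inv[OF r]

lemma card_K: "card K \<noteq> 0"
  using finite_K K_closed(1) by auto

lemma pi_linear: "n \<in> K \<Longrightarrow> Vector_Spaces.linear sV sV (\<pi> n)"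
  using rep by (simp add: is_rep_def)

lemma pi_simps:
  assumes "n \<in> K"
  shows "\<pi> n (sV a x) = sV a (\<pi> n x)" "\<pi> n 0 = 0" "\<pi> n (x + y) = \<pi> n x + \<pi> n y"
    "\<pi> n (sum f A) = (\<Sum>j\<in>A. \<pi> n (f j))"
proof -
  interpret pn: Vector_Spaces.linear sV sV "\<pi> n" by (rule pi_linear[OF assms])
  show "\<pi> n (sV a x) = sV a (\<pi> n x)" "\<pi> n 0 = 0" "\<pi> n (x + y) = \<pi> n x + \<pi> n y"
    "\<pi> n (sum f A) = (\<Sum>j\<in>A. \<pi> n (f j))"
    by (simp_all add: pn.scale pn.add pn.sum pn.zero)
qed

lemma pi_one: "\<pi> \<one> v = v"
  using rep by (simp add: is_rep_def)

lemma pi_pi: "m \<in> K \<Longrightarrow> n \<in> K \<Longrightarrow> \<pi> m (\<pi> n v) = \<pi> (m \<otimes> n) v"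
  using rep by (simp add: is_rep_def)

lemma pi_inv: "n \<in> K \<Longrightarrow> \<pi> n (\<pi> (inv n) v) = v" "n \<in> K \<Longrightarrow> \<pi> (inv n) (\<pi> n v) = v"
  by (simp_all add: pi_pi K_closed pi_one K_carrier)

text \<open>The case \<open>n = \<one>\<close> says that the image of \<open>\<phi>\<close> lies in
  degree \<open>r\<close>; the case \<open>h = r\<close> is equivariance under \<open>K\<close>.
  These two properties are all that is used of a comodule map.\<close>

lemma hom_iff:
  "right_comodule_hom (Hquot G r) sV (V_coact G r \<pi>) sW (pushout G r coW) \<phi> \<longleftrightarrow>
    Vector_Spaces.linear sV sW \<phi> \<and>
    (\<forall>v. \<forall>n\<in>K. \<forall>h\<in>carrier G. coW (\<phi> v) (n, h) = (if h = r then \<phi> (\<pi> n v) else 0))"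
proof -
  have "\<phi> 0 = 0" if "Vector_Spaces.linear sV sW \<phi>"
  proof -
    interpret Vector_Spaces.linear sV sW \<phi> by fact
    show ?thesis by (rule zero)
  qed
  then show ?thesis
    by (auto simp: right_comodule_hom_def codouble_def V_coact_def pushout_def proj_p_def)
qed

lemma iota_linear: "Vector_Spaces.linear sV sW \<iota>"
  using hom by (simp add: right_comodule_hom_def)

sublocale iota: Vector_Spaces.linear sV sW \<iota>
  by (rule iota_linear)

lemma coW_iota:
  "n \<in> K \<Longrightarrow> h \<in> carrier G \<Longrightarrow> coW (\<iota> v) (n, h) = (if h = r then \<iota> (\<pi> n v) else 0)"
  using hom unfolding hom_iff by blast

lemma act_iota: "n \<in> K \<Longrightarrow> act n (\<iota> v) = \<iota> (\<pi> n v)"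
  using r fin by (simp add: cm_act_def coW_iota)

text \<open>The very basis chosen inside \<open>lin_trace\<close>, so that traces unfold without an
  appeal to independence of the basis.\<close>

definition B where "B = V.extend_basis {}"

lemma B: "V.independent B" "V.span B = UNIV" "finite B" "B \<noteq> {}"
proof -
  show ind: "V.independent B" and sp: "V.span B = UNIV"
    by (simp_all add: B_def V.independent_extend_basis V.independent_empty V.span_extend_basis)
  obtain T where "finite T" "V.span T = UNIV"
    using irreducible_rep_finite_span[OF irr finite_K] K_closed by blast
  then show "finite B"
    using V.independent_span_bound[of T B] ind by auto
  obtain v :: 'v where "v \<noteq> 0"
    using irr unfolding irreducible_rep_def by blast
  then show "B \<noteq> {}"
    using sp by (metis V.span_empty UNIV_I singletonD)
qed

lemma dim_V: "V.dim UNIV = card B"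
  using V.dim_eq_card[of B UNIV] B by simp

abbreviation \<beta> where "\<beta> b v \<equiv> V.representation B v b"

lemma beta_simps:
  "\<beta> b (x + y) = \<beta> b x + \<beta> b y" "\<beta> b (sV a x) = a * \<beta> b x"
  "\<beta> b (sum f A) = (\<Sum>j\<in>A. \<beta> b (f j))"
  using B by (simp_all add: V.representation_add V.representation_scale V.representation_sum)

lemma sum_beta: "(\<Sum>b\<in>B. sV (\<beta> b v) b) = v"
  using B V.sum_representation_eq[of B v B] by simp

lemma lin_trace_eq: "lin_trace sV f = (\<Sum>b\<in>B. \<beta> b (f b))"
  by (simp add: lin_trace_def B_def Let_def)

abbreviation P where "P \<equiv> dbl_act G sW coW (P_rpi G r sV \<pi>)"

text \<open>
  \<open>matrix_average w b\<close> is the sum over \<open>n\<close> of \<open>\<beta> b (\<pi> (inv n) v) n \<triangleright> w\<^sub>r\<close>.  Being a comodule map,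
  it is a multiple of \<open>\<iota>\<close> by multiplicity one, which thus also replaces Schur's lemma for \<open>\<pi>\<close>.
\<close>

definition matrix_average where
  "matrix_average w b v = (\<Sum>n\<in>K. sW (\<beta> b (\<pi> (inv n) v)) (coW w (n, r)))"

text \<open>The factor at \<open>r\<close> leaves only \<open>g = r\<close>, conjugation by
  \<open>K\<close> fixes \<open>r\<close>, and expanding the character over \<open>B\<close> yields
  the diagonal matrix averages.\<close>

lemma P_eq:
  "P w = sW (of_nat (card B) / of_nat (card K)) (\<Sum>b\<in>B. matrix_average w b b)"
proof -
  let ?c = "\<lambda>n. of_nat (card B) / of_nat (card K) * lin_trace sV (\<pi> (inv n))"
  have "P w = (\<Sum>g\<in>carrier G. if g = r then (\<Sum>h\<in>carrier G. if h \<in> K then sW (?c h) (coW w (h, r)) else 0) else 0)"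
    unfolding dbl_act_eq
  proof (intro sum.cong refl, goal_cases)
    case (1 g)
    show ?case
    proof (cases "g = r")
      case True
      have "inv h \<otimes> r \<otimes> h = r" if "h \<in> K" for h
        using that r by (metis centraliser_iff conj_eq_iff)
      with True show ?thesis
        by (auto simp: P_rpi_def dim_V intro!: sum.cong)
    qed (auto simp: P_rpi_def)
  qed
  also have "\<dots> = (\<Sum>n\<in>K. sW (?c n) (coW w (n, r)))"
    using r fin centraliser_subset[of r]
    by (simp add: sum.inter_restrict[symmetric] Int_absorb1)
  also have "\<dots> = sW (of_nat (card B) / of_nat (card K)) (\<Sum>b\<in>B. matrix_average w b b)"
    unfolding matrix_average_def lin_trace_eq
    by (subst sum.swap) (simp add: W.scale_sum_right W.scale_sum_left sum_distrib_left)
  finally show ?thesis .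
qed

text \<open>Substituting \<open>m \<otimes> n\<close> for \<open>n\<close> in the average moves
  \<open>m\<close> from the vector of \<open>W\<close> to the argument \<open>v\<close>.\<close>

lemma matrix_average_hom:
  "right_comodule_hom (Hquot G r) sV (V_coact G r \<pi>) sW (pushout G r coW) (matrix_average w b)"
  unfolding hom_iff
proof (intro conjI allI ballI)
  show "Vector_Spaces.linear sV sW (matrix_average w b)"
    by unfold_locales
      (simp_all add: matrix_average_def pi_simps K_closed beta_simps W.scale_sum_right
        W.scale_left_distrib sum.distrib)
next
  fix v m h assume m: "m \<in> K" and h: "h \<in> carrier G"
  have K_conj: "n \<otimes> r \<otimes> inv n = r" if "n \<in> K" for n
    using that r by (simp add: centraliser_iff)
  have bij: "bij_betw (\<lambda>n. m \<otimes> n) K K"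
    using m by (intro bij_betwI[where g = "\<lambda>n. inv m \<otimes> n"])
      (auto simp: K_closed K_carrier m_assoc[symmetric])
  have "coW (matrix_average w b v) (m, h) =
      (if h = r then \<Sum>n\<in>K. sW (\<beta> b (\<pi> (inv n) v)) (coW w (m \<otimes> n, r)) else 0)"
    using m h r by (simp add: matrix_average_def coW_simps coW_iterate K_carrier K_conj)
  also have "(\<Sum>n\<in>K. sW (\<beta> b (\<pi> (inv n) v)) (coW w (m \<otimes> n, r))) =
      (\<Sum>n\<in>K. sW (\<beta> b (\<pi> (inv (m \<otimes> n)) (\<pi> m v))) (coW w (m \<otimes> n, r)))"
    using m by (intro sum.cong refl)
      (simp add: pi_pi K_closed K_carrier inv_mult_group m_assoc)
  also have "\<dots> = matrix_average w b (\<pi> m v)"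
    unfolding matrix_average_def by (rule sum.reindex_bij_betw[OF bij])
  finally show "coW (matrix_average w b v) (m, h) = (if h = r then matrix_average w b (\<pi> m v) else 0)" .
qed

text \<open>Multiplicity one makes each \<open>matrix_average w b\<close> a multiple of
  \<open>\<iota>\<close>. With further copies of the representation in \<open>W\<close> these
  averages could leave \<open>range \<iota>\<close>.\<close>

lemma P_in_range: "P w \<in> range \<iota>"
proof -
  have "\<forall>b. \<exists>a. \<forall>v. matrix_average w b v = sW a (\<iota> v)"
    using multiplicity_one[OF matrix_average_hom] by blast
  then obtain a where "\<And>b v. matrix_average w b v = sW (a b) (\<iota> v)" by metis
  then have "P w = \<iota> (sV (of_nat (card B) / of_nat (card K)) (\<Sum>b\<in>B. sV (a b) b))"
    by (simp add: P_eq iota.scale iota.sum)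
  then show ?thesis by blast
qed

text \<open>This is Schur orthogonality: the averaged operator \<open>\<psi> b\<close> is a scalar,
  and its trace determines the scalar. The factor \<open>card B / card K\<close> in \<open>P\<close>
  is the inverse of the constant that appears.\<close>

lemma P_iota: "P (\<iota> u) = \<iota> u"
proof -
  define \<psi> where "\<psi> b v = (\<Sum>n\<in>K. sV (\<beta> b (\<pi> (inv n) v)) (\<pi> n u))" for b v
  have avg: "matrix_average (\<iota> u) b v = \<iota> (\<psi> b v)" for b v
    using r by (simp add: matrix_average_def \<psi>_def iota.sum iota.scale coW_iota)
  have d: "of_nat (card B) \<noteq> (0::complex)"
    using B by simp
  have "\<psi> b v = sV (of_nat (card K) / of_nat (card B) * \<beta> b u) v" for b v
  proof -
    obtain a where "\<And>v. matrix_average (\<iota> u) b v = sW a (\<iota> v)"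
      using multiplicity_one[OF matrix_average_hom] by blast
    then have a: "\<psi> b v = sV a v" for v
      using inj by (simp add: avg inj_eq flip: iota.scale)
    \<comment> \<open>The trace of \<open>\<psi> b\<close>, computed from the scalar on one side. On
      the other side the sum over \<open>c\<close> reassembles \<open>\<pi> n u\<close> from its
      coordinates, after which \<open>\<pi> (inv n)\<close> cancels \<open>\<pi> n\<close>.\<close>
    have "of_nat (card B) * a = (\<Sum>c\<in>B. \<beta> c (\<psi> b c))"
      using B(1) by (simp add: a beta_simps V.representation_basis)
    also have "\<dots> = (\<Sum>n\<in>K. \<beta> b (\<pi> (inv n) (\<Sum>c\<in>B. sV (\<beta> c (\<pi> n u)) c)))"
      unfolding \<psi>_def beta_simps
      by (subst sum.swap) (simp add: pi_simps K_closed beta_simps mult.commute)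
    also have "\<dots> = of_nat (card K) * \<beta> b u"
      by (simp add: sum_beta pi_inv)
    finally show ?thesis
      using d by (simp add: a field_simps)
  qed
  then have "P (\<iota> u) = \<iota> (\<Sum>b\<in>B. sV (of_nat (card B) / of_nat (card K) * (of_nat (card K) / of_nat (card B) * \<beta> b u)) b)"
    by (simp add: P_eq avg iota.sum iota.scale W.scale_sum_right)
  also have "(\<lambda>b. of_nat (card B) / of_nat (card K) * (of_nat (card K) / of_nat (card B) * \<beta> b u)) = (\<lambda>b. \<beta> b u)"
    using d card_K by simp
  finally show ?thesis
    by (simp add: sum_beta)
qed

lemma P_fixed_iff: "P w = w \<longleftrightarrow> w \<in> range \<iota>"
  using P_in_range[of w] P_iota by auto

end

section \<open>Transport of a comodule structure along a linear bijection\<close>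

lemma basis_codouble: "basis (codouble G L) = L \<times> carrier G"
  by (simp add: codouble_def)

lemma counitc_codouble: "counitc (codouble G L) (g, h) = of_bool (g = \<one>\<^bsub>G\<^esub>)"
  by (simp add: codouble_def)

lemma sum_fun_apply: "(\<Sum>i\<in>I. f i) x = (\<Sum>i\<in>I. f i x)"
  for f :: "'i \<Rightarrow> 'x \<Rightarrow> 'v::comm_monoid_add"
  by (induction I rule: infinite_finite_induct) simp_all

text \<open>Each axiom on \<open>N\<close> is the image under \<open>f\<close> of the axiom on
  \<open>M\<close>. In particular neither closure of \<open>N\<close> under \<open>coN\<close> nor
  coassociativity there has to be verified by hand.\<close>

lemma left_comodule_isomorphicI:
  fixes A :: "('i, 'z) bialg_scheme"
  assumes M: "left_comodule A sM M coM" and sN: "vector_space sN"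
    and f: "linear_map_on sM M sN UNIV f" "bij_betw f M N"
    and hom: "\<And>x i. x \<in> M \<Longrightarrow> i \<in> basis A \<Longrightarrow> coN (f x) i = f (coM x i)"
    and off: "\<And>y i. y \<in> N \<Longrightarrow> i \<notin> basis A \<Longrightarrow> coN y i = 0"
  shows "left_comodule_isomorphic A sM M coM sN N coN"
proof -
  interpret M: vector_space sM using M by (simp add: left_comodule_def)
  interpret N: vector_space sN by fact
  have sub: "M.subspace M" and coM_linear: "\<And>i. linear_map_on sM M sM M (\<lambda>x. coM x i)"
    and coM_off: "\<And>x i. x \<in> M \<Longrightarrow> i \<notin> basis A \<Longrightarrow> coM x i = 0"
    and coassoc: "\<And>x j k. x \<in> M \<Longrightarrow> j \<in> basis A \<Longrightarrow> k \<in> basis A \<Longrightarrow>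
      coM (coM x j) k = (\<Sum>i\<in>basis A. sM (coprodc A i (j, k)) (coM x i))"
    and counit: "\<And>x. x \<in> M \<Longrightarrow> (\<Sum>i\<in>basis A. sM (counitc A i) (coM x i)) = x"
    using M by (simp_all add: left_comodule_def)
  have f_add: "f (x + y) = f x + f y" and f_scale: "f (sM a x) = sN a (f x)"
    if "x \<in> M" "y \<in> M" for x y a
    using f(1) that by (simp_all add: linear_map_on_def)
  have coM_M: "coM x i \<in> M" and coM_add: "coM (x + y) i = coM x i + coM y i"
    and coM_scale: "coM (sM a x) i = sM a (coM x i)"
    if "x \<in> M" "y \<in> M" for x y a i
    using coM_linear[of i] that by (simp_all add: linear_map_on_def)
  have zero: "0 \<in> M" and add: "x \<in> M \<Longrightarrow> y \<in> M \<Longrightarrow> x + y \<in> M" and scale: "x \<in> M \<Longrightarrow> sM a x \<in> M" for x y a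
    using sub by (simp_all add: M.subspace_def)
  have f_zero: "f 0 = 0"
    using f_add[OF zero zero] by simp
  have f_sum: "f (sum g I) = (\<Sum>i\<in>I. f (g i))" if "\<And>i. i \<in> I \<Longrightarrow> g i \<in> M" for g and I :: "'i set"
    using that
    by (induction I rule: infinite_finite_induct)
       (simp_all add: f_zero f_add M.subspace_sum[OF sub])
  have N_eq: "N = f ` M"
    using f(2) by (simp add: bij_betw_def)
  \<comment> \<open>Off the basis both sides vanish, so the intertwining relation holds for every
    index and can be used as a rewrite rule.\<close>
  have hom': "coN (f x) i = f (coM x i)" if "x \<in> M" for x i
    using that hom[of x i] off[of "f x" i] coM_off[of x i] f_zero N_eq by (cases "i \<in> basis A") auto
  have "N.subspace N"
    unfolding N_eq N.subspace_def using zero add scale f_zero f_add f_scale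
    by (auto simp: image_iff) (metis f_add f_scale)+
  moreover have "linear_map_on sN N sN N (\<lambda>x. coN x i)" for i
    unfolding N_eq linear_map_on_def
  proof (intro conjI ballI allI; elim imageE; hypsubst)
    fix x y a assume x: "x \<in> M"
    show "coN (f x) i \<in> f ` M" using x by (simp add: hom' coM_M)
    show "coN (sN a (f x)) i = sN a (coN (f x) i)"
      using x by (simp add: hom' scale coM_scale coM_M flip: f_scale)
    show "coN (f x + f y) i = coN (f x) i + coN (f y) i" if "y \<in> M"
      using x that by (simp add: hom' add coM_add coM_M flip: f_add)
  qed
  moreover have "coN (coN (f x) j) k = (\<Sum>i\<in>basis A. sN (coprodc A i (j, k)) (coN (f x) i))"
    if "x \<in> M" "j \<in> basis A" "k \<in> basis A" for x j k
    using that by (simp add: hom' coM_M coassoc f_sum scale f_scale)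
  moreover have "(\<Sum>i\<in>basis A. sN (counitc A i) (coN (f x) i)) = f x" if "x \<in> M" for x
  proof -
    have "(\<Sum>i\<in>basis A. sN (counitc A i) (coN (f x) i)) =
        f (\<Sum>i\<in>basis A. sM (counitc A i) (coM x i))"
      using that by (simp add: hom' coM_M f_sum scale f_scale)
    then show ?thesis using that by (simp add: counit)
  qed
  ultimately have "left_comodule A sN N coN"
    using sN off unfolding left_comodule_def N_eq by auto
  moreover have "left_comodule_hom A sM M coM sN N coN f"
    using f hom N_eq by (auto simp: left_comodule_hom_def linear_map_on_def)
  ultimately show ?thesis
    using M f(2) unfolding left_comodule_isomorphic_def by blast
qed

section \<open>The comodule of invariants\<close>

context comodule_embedding
begin

text \<open>The coaction on \<open>V\<close> always has second leg \<open>r\<close>. Writing the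
  second leg of the index in \<open>H\<close> as \<open>y \<otimes> r\<close> therefore pins down
  the factors \<open>(n, y)\<close> and \<open>(n, r)\<close>, and the triple sum has one possible
  term.\<close>

lemma tensor_coact_eq:
  assumes C: "f \<in> carrier G" "h \<in> carrier G" "n \<in> K" "y \<in> carrier G"
  shows "tensor_coact G r sV (V_coact G r \<pi>) X (n, y \<otimes> r) (f, h) =
    (if h = n \<otimes> y \<otimes> inv n then \<pi> n (X (f \<otimes> n, y)) else 0)" (is "_ = ?val")
proof -
  let ?summand = "\<lambda>i j l. sV (proj_p G r (\<lambda>j'. coprodc (Dvee G) i ((f, h), j')) j *
      prodc (Hquot G r) j l (n, y \<otimes> r)) (V_coact G r \<pi> (X i) l)"
  have eq: "?summand i j l =
      (if i = (f \<otimes> n, y) then if j = (n, y) then if l = (n, r) then ?val else 0 else 0 else 0)"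
    if ijl: "i \<in> carrier G \<times> carrier G" "j \<in> K \<times> carrier G" "l \<in> K \<times> carrier G" for i j l
  proof -
    obtain g x j1 j2 l1 l2 where [simp]: "i = (g, x)" "j = (j1, j2)" "l = (l1, l2)"
      by (metis surj_pair)
    have C': "g \<in> carrier G" "x \<in> carrier G" "j1 \<in> K" "j2 \<in> carrier G" "l1 \<in> K" "l2 \<in> carrier G"
      using ijl by simp_all
    have "y \<otimes> r = j2 \<otimes> r \<longleftrightarrow> y = j2"
      using C C' r by auto
    then show ?thesis
      using C C' r by (auto simp: proj_p_def coprodc_Dvee K_carrier V_coact_def codouble_def[of G K])
  qed
  have "tensor_coact G r sV (V_coact G r \<pi>) X (n, y \<otimes> r) (f, h) =
    (\<Sum>i\<in>carrier G \<times> carrier G. \<Sum>j\<in>K \<times> carrier G. \<Sum>l\<in>K \<times> carrier G.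
      if i = (f \<otimes> n, y) then if j = (n, y) then if l = (n, r) then ?val else 0 else 0 else 0)"
    unfolding tensor_coact_def
    by (intro sum.cong eq) (simp_all add: basis_codouble)
  also have "\<dots> = (\<Sum>i\<in>carrier G \<times> carrier G. if i = (f \<otimes> n, y) then
      \<Sum>j\<in>K \<times> carrier G. if j = (n, y) then \<Sum>l\<in>K \<times> carrier G. if l = (n, r) then ?val else 0 else 0 else 0)"
    by (intro sum.cong refl) (auto intro!: sum.cong)
  also have "\<dots> = ?val"
    using C r fin finite_K by (simp add: sum.delta K_carrier)
  finally show ?thesis .
qed

text \<open>The unit of \<open>H\<close> has second leg \<open>\<one>\<close>, and
  \<open>y \<otimes> r = \<one>\<close> means \<open>y = inv r\<close>. Comparing coefficients
  splits invariance into a support condition and equivariance under right translation by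
  \<open>K\<close>.\<close>

lemma E_space_iff:
  "X \<in> E_space G r sV \<pi> \<longleftrightarrow>
    (\<forall>f h. f \<notin> carrier G \<or> h \<noteq> inv r \<longrightarrow> X (f, h) = 0) \<and>
    (\<forall>f\<in>carrier G. \<forall>n\<in>K. \<pi> n (X (f \<otimes> n, inv r)) = X (f, inv r))" (is "_ \<longleftrightarrow> ?supp \<and> ?equi")
proof -
  have "X \<in> E_space G r sV \<pi> \<longleftrightarrow>
    (\<forall>i. i \<notin> carrier G \<times> carrier G \<longrightarrow> X i = 0) \<and>
    (\<forall>f\<in>carrier G. \<forall>h\<in>carrier G. \<forall>n\<in>K. \<forall>m\<in>carrier G.
      tensor_coact G r sV (V_coact G r \<pi>) X (n, m) (f, h) = sV (of_bool (m = \<one>)) (X (f, h)))"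
    by (auto simp: E_space_def codouble_def)
  also have "\<dots> \<longleftrightarrow> (\<forall>i. i \<notin> carrier G \<times> carrier G \<longrightarrow> X i = 0) \<and>
    (\<forall>f\<in>carrier G. \<forall>h\<in>carrier G. \<forall>n\<in>K. \<forall>y\<in>carrier G.
      tensor_coact G r sV (V_coact G r \<pi>) X (n, y \<otimes> r) (f, h) = sV (of_bool (y \<otimes> r = \<one>)) (X (f, h)))"
  proof -
    \<comment> \<open>Right translation by \<open>r\<close> is a bijection, so every index can be
      brought into the shape required by \<open>tensor_coact_eq\<close>.\<close>
    have reindex: "(\<forall>m\<in>carrier G. R m) \<longleftrightarrow> (\<forall>y\<in>carrier G. R (y \<otimes> r))" for R
    proof (intro iffI ballI)
      fix m assume R: "\<forall>y\<in>carrier G. R (y \<otimes> r)" and m: "m \<in> carrier G"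
      then have "R (m \<otimes> inv r \<otimes> r)" using r by blast
      then show "R m" using r m by (simp add: m_assoc)
    qed (use r in auto)
    show ?thesis
      by (rule conj_cong[OF refl], rule ball_cong[OF refl], rule ball_cong[OF refl],
        rule ball_cong[OF refl], rule reindex)
  qed
  also have "\<dots> \<longleftrightarrow> (\<forall>i. i \<notin> carrier G \<times> carrier G \<longrightarrow> X i = 0) \<and>
    (\<forall>f\<in>carrier G. \<forall>h\<in>carrier G. \<forall>n\<in>K. \<forall>y\<in>carrier G.
      (if h = n \<otimes> y \<otimes> inv n then \<pi> n (X (f \<otimes> n, y)) else 0) = (if y = inv r then X (f, h) else 0))"
    (is "_ \<longleftrightarrow> ?off \<and> ?inv")
  proof -
    have "y \<otimes> r = \<one> \<longleftrightarrow> y = inv r" if "y \<in> carrier G" for y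
      using that r by (metis inv_equality l_inv)
    then show ?thesis
      by (simp add: tensor_coact_eq of_bool_def if_distrib[where f = "\<lambda>c. sV c _"] cong: if_cong)
  qed
  also have "\<dots> \<longleftrightarrow> ?supp \<and> ?equi"
  proof (rule iffI)
    assume L: "?off \<and> ?inv"
    then have inv: "(if h = n \<otimes> y \<otimes> inv n then \<pi> n (X (f \<otimes> n, y)) else 0) = (if y = inv r then X (f, h) else 0)"
      if "f \<in> carrier G" "h \<in> carrier G" "n \<in> K" "y \<in> carrier G" for f h n y
      using that by blast
    \<comment> \<open>At \<open>n = \<one>\<close> and \<open>y = h\<close> invariance reads
      \<open>X (f, h) = 0\<close> unless \<open>h = inv r\<close>.\<close>
    have "X (f, h) = 0" if "f \<notin> carrier G \<or> h \<noteq> inv r" for f h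
    proof (cases "f \<in> carrier G \<and> h \<in> carrier G")
      case True
      then show ?thesis
        using inv[of f h \<one> h] that K_closed(1) by (simp add: pi_one)
    qed (use L in auto)
    moreover have "\<pi> n (X (f \<otimes> n, inv r)) = X (f, inv r)" if "f \<in> carrier G" "n \<in> K" for f n
      using inv[of f "inv r" n "inv r"] that r by (simp add: centraliser_conj_inv)
    ultimately show "?supp \<and> ?equi" by blast
  next
    assume R: "?supp \<and> ?equi"
    have "X i = 0" if "i \<notin> carrier G \<times> carrier G" for i
      using R that inv_closed[OF r] by (cases i) (metis SigmaI)
    moreover have "(if h = n \<otimes> y \<otimes> inv n then \<pi> n (X (f \<otimes> n, y)) else 0) = (if y = inv r then X (f, h) else 0)"
      if C: "f \<in> carrier G" "h \<in> carrier G" "n \<in> K" "y \<in> carrier G" for f h n y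
      using R C r centraliser_conj_inv[OF r C(3)] by (auto simp: pi_simps)
    ultimately show "?off \<and> ?inv" by blast
  qed
  finally show ?thesis .
qed

lemma E_coact_eq:
  "E_coact G sV X (a, b) (c, d) =
    (if a \<in> carrier G \<and> b \<in> carrier G \<and> c \<in> carrier G \<and> d \<in> carrier G \<and> b = c \<otimes> d \<otimes> inv c
     then X (a \<otimes> c, d) else 0)"
proof (cases "a \<in> carrier G \<and> b \<in> carrier G \<and> c \<in> carrier G \<and> d \<in> carrier G")
  case True
  have "(\<Sum>i\<in>carrier G \<times> carrier G. sV (coprodc (Dvee G) i ((a, b), (c, d))) (X i)) =
    (\<Sum>i\<in>carrier G \<times> carrier G. if i = (a \<otimes> c, d) then
      (if b = c \<otimes> d \<otimes> inv c then X (a \<otimes> c, d) else 0) else 0)"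
    using True by (intro sum.cong refl) (auto simp: coprodc_Dvee)
  then show ?thesis
    using True fin by (auto simp: E_coact_def basis_codouble)
qed (auto simp: E_coact_def basis_codouble)

text \<open>The coaction translates \<open>f\<close> by \<open>a\<close> on the left, which commutes
  with the right translations by \<open>K\<close>. The condition on \<open>b\<close> is unaffected
  as well, since \<open>K\<close> fixes \<open>inv r\<close> under conjugation.\<close>

lemma E_coact_closed:
  assumes "X \<in> E_space G r sV \<pi>"
  shows "E_coact G sV X j \<in> E_space G r sV \<pi>"
proof -
  obtain a b where j: "j = (a, b)" by force
  have "a \<otimes> (f \<otimes> n) = (a \<otimes> f) \<otimes> n \<and> (f \<otimes> n) \<otimes> inv r \<otimes> inv (f \<otimes> n) = f \<otimes> inv r \<otimes> inv f"
    if "a \<in> carrier G" "f \<in> carrier G" "n \<in> K" for f n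
    using that r by (simp add: m_assoc[of a] K_carrier conj_conj[symmetric] centraliser_conj_inv)
  then show ?thesis
    using assms r unfolding j E_space_iff by (auto simp: E_coact_eq K_carrier pi_simps)
qed

lemma E_left_comodule: "left_comodule (Dvee G) (fscale sV) (E_space G r sV \<pi>) (E_coact G sV)"
proof -
  interpret F: vector_space "fscale sV :: _ \<Rightarrow> ('a \<times> 'a \<Rightarrow> 'v) \<Rightarrow> _"
    by (rule vector_space_fscale) (rule V.vector_space_axioms)
  let ?C = "carrier G"
  have "F.subspace (E_space G r sV \<pi>)"
    unfolding F.subspace_def by (auto simp: E_space_iff fscale_def pi_simps)
  moreover have "linear_map_on (fscale sV) (E_space G r sV \<pi>) (fscale sV) (E_space G r sV \<pi>)
      (\<lambda>x. E_coact G sV x i)" for i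
    unfolding linear_map_on_def
    by (cases i) (auto simp: E_coact_closed fun_eq_iff E_coact_eq fscale_def)
  moreover have "E_coact G sV X i = 0" if "i \<notin> basis (Dvee G)" for X i
    using that by (cases i) (auto simp: fun_eq_iff E_coact_eq basis_codouble)
  moreover have "E_coact G sV (E_coact G sV X j) k =
      (\<Sum>i\<in>basis (Dvee G). fscale sV (coprodc (Dvee G) i (j, k)) (E_coact G sV X i))"
    if jk: "j \<in> basis (Dvee G)" "k \<in> basis (Dvee G)" for X :: "'a \<times> 'a \<Rightarrow> 'v" and j k
  proof
    fix e :: "'a \<times> 'a"
    obtain a b c d where j: "j = (a, b)" and k: "k = (c, d)" and
      C: "a \<in> ?C" "b \<in> ?C" "c \<in> ?C" "d \<in> ?C"
      using jk by (auto simp: basis_codouble)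
    obtain e1 e2 where e: "e = (e1, e2)" by force
    have "(\<Sum>i\<in>basis (Dvee G). fscale sV (coprodc (Dvee G) i (j, k)) (E_coact G sV X i)) e =
      (\<Sum>i\<in>?C \<times> ?C. if i = (a \<otimes> c, d) then
        (if b = c \<otimes> d \<otimes> inv c then E_coact G sV X (a \<otimes> c, d) e else 0) else 0)"
      unfolding sum_fun_apply
      by (intro sum.cong)
        (use C in \<open>auto simp: basis_codouble fscale_def j k coprodc_Dvee\<close>)
    also have "\<dots> = (if b = c \<otimes> d \<otimes> inv c then E_coact G sV X (a \<otimes> c, d) e else 0)"
      using C fin by simp
    also have "\<dots> = E_coact G sV (E_coact G sV X j) k e"
      using C by (auto simp: E_coact_eq j k e m_assoc inv_mult_group)
    finally show "E_coact G sV (E_coact G sV X j) k e =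
      (\<Sum>i\<in>basis (Dvee G). fscale sV (coprodc (Dvee G) i (j, k)) (E_coact G sV X i)) e" ..
  qed
  moreover have "(\<Sum>i\<in>basis (Dvee G). fscale sV (counitc (Dvee G) i) (E_coact G sV X i)) = X"
    if X: "X \<in> E_space G r sV \<pi>" for X
  proof
    fix e :: "'a \<times> 'a"
    obtain c d where e: "e = (c, d)" by force
    have X0: "X (c, d) = 0" if "c \<notin> ?C \<or> d \<notin> ?C"
      using X that r by (cases "d = inv r") (auto simp: E_space_iff)
    \<comment> \<open>The counit forces first leg \<open>\<one>\<close>, and
      \<open>E_coact_eq\<close> then determines the second leg.\<close>
    have "(\<Sum>i\<in>basis (Dvee G). fscale sV (counitc (Dvee G) i) (E_coact G sV X i)) e =
      (\<Sum>i\<in>?C \<times> ?C. if i = (\<one>, c \<otimes> d \<otimes> inv c) then X (c, d) else 0)"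
      unfolding sum_fun_apply
    proof (intro sum.cong, goal_cases)
      case (2 i)
      then show ?case
        using X r by (cases i) (auto simp: counitc_codouble basis_codouble fscale_def e E_coact_eq X0)
    qed (simp add: basis_codouble)
    also have "\<dots> = X e"
      using fin X0 by (auto simp: e)
    finally show "(\<Sum>i\<in>basis (Dvee G). fscale sV (counitc (Dvee G) i) (E_coact G sV X i)) e = X e" .
  qed
  ultimately show ?thesis
    unfolding left_comodule_def using F.vector_space_axioms by blast
qed

end

section \<open>Sections over the class of the inverse of \<open>r\<close>\<close>

locale framed_comodule_embedding = comodule_embedding G sW coW r sV \<pi> \<iota>
  for G (structure) and sW :: "complex \<Rightarrow> 'w::ab_group_add \<Rightarrow> 'w" and coW and r
    and sV :: "complex \<Rightarrow> 'v::ab_group_add \<Rightarrow> 'v" and \<pi> \<iota> +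
  fixes Q
  assumes Q_closed: "g \<in> carrier G \<Longrightarrow> Q g \<in> carrier G"
    and Q_conj: "g \<in> conj_class G (inv r) \<Longrightarrow> Q g \<otimes> inv r \<otimes> inv (Q g) = g"
begin

abbreviation "E \<equiv> E_space G r sV \<pi>"
abbreviation "D \<equiv> conj_class G (inv r)"

lemma D_carrier: "g \<in> D \<Longrightarrow> g \<in> carrier G"
  using conj_class_subset[of "inv r"] r by auto

lemma conj_in_D: "f \<in> carrier G \<Longrightarrow> f \<otimes> inv r \<otimes> inv f \<in> D"
  by (auto simp: conj_class_def)

text \<open>Fixing \<open>inv r\<close> under conjugation is the same as fixing \<open>r\<close>. A
  frame over a point of \<open>D\<close> is therefore unique up to right multiplication by
  \<open>K\<close>.\<close>

lemma centraliser_quotient: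
  assumes "f \<in> carrier G" "h \<in> carrier G" "f \<otimes> inv r \<otimes> inv f = h \<otimes> inv r \<otimes> inv h"
  shows "inv f \<otimes> h \<in> K"
proof -
  have "(inv f \<otimes> h) \<otimes> inv r \<otimes> inv (inv f \<otimes> h) = inv f \<otimes> (f \<otimes> inv r \<otimes> inv f) \<otimes> inv (inv f)"
    using assms r conj_conj[of "inv f" h "inv r"] by simp
  also have "\<dots> = inv r"
    using assms(1) r conj_conj[of "inv f" f "inv r"] by simp
  finally show ?thesis
    using assms r inv_conj[of "inv f \<otimes> h" "inv r"] by (simp add: centraliser_iff)
qed

definition section_of where
  "section_of X g = (if g \<in> D then act (Q g) (\<iota> (X (Q g, inv r))) else 0)"

text \<open>The frame \<open>Q g\<close> in \<open>section_of\<close> may be replaced by any other: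
  the two differ by an element of \<open>K\<close>, and equivariance of \<open>X\<close> turns this
  into the action of \<open>K\<close> on \<open>range \<iota>\<close>.\<close>

lemma section_of_conj:
  assumes X: "X \<in> E" and f: "f \<in> carrier G"
  shows "section_of X (f \<otimes> inv r \<otimes> inv f) = act f (\<iota> (X (f, inv r)))"
proof -
  define h where "h = Q (f \<otimes> inv r \<otimes> inv f)"
  have h: "h \<in> carrier G" "h \<otimes> inv r \<otimes> inv h = f \<otimes> inv r \<otimes> inv f"
    using conj_in_D[OF f] f r by (simp_all add: h_def Q_closed Q_conj)
  then have n: "inv h \<otimes> f \<in> K"
    using f by (intro centraliser_quotient)
  have "h \<otimes> (inv h \<otimes> f) = f"
    using h f by (simp add: m_assoc[symmetric])
  then have "X (h, inv r) = \<pi> (inv h \<otimes> f) (X (f, inv r))"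
    using X h n by (metis E_space_iff)
  then have "act h (\<iota> (X (h, inv r))) = act h (act (inv h \<otimes> f) (\<iota> (X (f, inv r))))"
    using n by (simp add: act_iota)
  then show ?thesis
    using \<open>h \<otimes> (inv h \<otimes> f) = f\<close> h f conj_in_D[OF f] by (simp add: section_of_def act_act flip: h_def)
qed

text \<open>The target with the eigenvalue equation replaced by its intended effect on supports. The
  Laplacian is compared with this space only at the end.\<close>

definition "S = {t \<in> CGW G. P_cov G sW coW (P_rpi G r sV \<pi>) Q t = t \<and> (\<forall>g. g \<notin> D \<longrightarrow> t g = 0)}"

text \<open>Undoing the invertible action of \<open>Q g\<close> turns the fixed section equation at
  \<open>g\<close> into a fixed point equation for \<open>P\<close>, to which
  \<open>P_fixed_iff\<close> applies.\<close>

lemma S_iff: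
  "t \<in> S \<longleftrightarrow> (\<forall>g. g \<notin> D \<longrightarrow> t g = 0) \<and> (\<forall>g\<in>D. act (inv (Q g)) (t g) \<in> range \<iota>)"
proof -
  have fixed: "P_cov G sW coW (P_rpi G r sV \<pi>) Q t g = t g \<longleftrightarrow> act (inv (Q g)) (t g) \<in> range \<iota>"
    if "g \<in> carrier G" for g
  proof -
    have "act (Q g) (P (act (inv (Q g)) (t g))) = t g \<longleftrightarrow>
      P (act (inv (Q g)) (t g)) = act (inv (Q g)) (t g)"
      using that by (metis Q_closed act_inv_act)
    then show ?thesis
      using that by (simp add: P_cov_eq Q_closed P_fixed_iff)
  qed
  have "0 \<in> range \<iota>"
    by (metis iota.zero rangeI)
  then have "P_cov G sW coW (P_rpi G r sV \<pi>) Q t g = t g"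
    if "\<forall>g. g \<notin> D \<longrightarrow> t g = 0" "\<forall>g\<in>D. act (inv (Q g)) (t g) \<in> range \<iota>" for g
  proof (cases "g \<in> carrier G")
    case True
    have "act (inv (Q g)) (t g) \<in> range \<iota>"
      using that \<open>0 \<in> range \<iota>\<close> by (cases "g \<in> D") (simp_all add: act_simps(2))
    then show ?thesis
      using fixed[OF True] by blast
  next
    case False
    then show ?thesis
      using that D_carrier by (auto simp: P_cov_def)
  qed
  moreover have "act (inv (Q g)) (t g) \<in> range \<iota>"
    if "P_cov G sW coW (P_rpi G r sV \<pi>) Q t = t" "g \<in> D" for g
    using that fixed[OF D_carrier] by simp
  ultimately show ?thesis
    unfolding S_def CGW_def using D_carrier by blast
qed

text \<open>Membership in \<open>S\<close> does not depend on the frames either, because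
  \<open>range \<iota>\<close> is stable under \<open>K\<close>.\<close>

lemma S_range:
  assumes t: "t \<in> S" and f: "f \<in> carrier G"
  shows "act (inv f) (t (f \<otimes> inv r \<otimes> inv f)) \<in> range \<iota>"
proof -
  define g where "g = f \<otimes> inv r \<otimes> inv f"
  have g: "g \<in> D" using conj_in_D[OF f] by (simp add: g_def)
  then have Qg: "Q g \<in> carrier G" "Q g \<otimes> inv r \<otimes> inv (Q g) = g"
    by (simp_all add: Q_closed Q_conj D_carrier)
  obtain u where u: "act (inv (Q g)) (t g) = \<iota> u"
    using t g by (auto simp: S_iff)
  have n: "inv f \<otimes> Q g \<in> K"
    using centraliser_quotient[OF f Qg(1)] Qg(2) by (simp add: g_def)
  have "act (inv f) (t g) = act (inv f \<otimes> Q g) (\<iota> u)"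
    using Qg(1) f by (simp add: u[symmetric] act_act m_assoc)
  then show ?thesis
    using n by (simp add: act_iota g_def)
qed

lemma section_of_bij: "bij_betw section_of E S"
proof (rule bij_betw_imageI)
  show "inj_on section_of E"
  proof (intro inj_onI ext)
    fix X Y and i :: "'a \<times> 'a" assume X: "X \<in> E" and Y: "Y \<in> E" and eq: "section_of X = section_of Y"
    obtain f h where i: "i = (f, h)" by force
    show "X i = Y i"
    proof (cases "f \<in> carrier G \<and> h = inv r")
      case True
      then have "act f (\<iota> (X i)) = act f (\<iota> (Y i))"
        using section_of_conj[OF X, of f] section_of_conj[OF Y, of f] eq by (simp add: i)
      then show ?thesis
        using True inj by (metis act_inv_act(1) injD)
    qed (use X Y in \<open>auto simp: i E_space_iff\<close>)
  qed
  show "section_of ` E = S"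
  proof (intro equalityI subsetI)
    fix t assume "t \<in> section_of ` E"
    then show "t \<in> S"
      by (auto simp: S_iff section_of_def act_inv_act Q_closed D_carrier)
  next
    fix t assume t: "t \<in> S"
    \<comment> \<open>The value is forced by \<open>section_of_conj\<close>: undo the action of
      \<open>f\<close>, then invert \<open>\<iota>\<close>. \<open>S_range\<close> guarantees that
      the vector has a preimage.\<close>
    define X where "X = (\<lambda>(f, h). if f \<in> carrier G \<and> h = inv r
      then inv_into UNIV \<iota> (act (inv f) (t (f \<otimes> inv r \<otimes> inv f))) else 0)"
    have iota_X: "\<iota> (X (f, inv r)) = act (inv f) (t (f \<otimes> inv r \<otimes> inv f))" if "f \<in> carrier G" for f
      using S_range[OF t that] that by (simp add: X_def f_inv_into_f)
    have "\<pi> n (X (f \<otimes> n, inv r)) = X (f, inv r)" if f: "f \<in> carrier G" and n: "n \<in> K" for f n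
    proof -
      have "(f \<otimes> n) \<otimes> inv r \<otimes> inv (f \<otimes> n) = f \<otimes> inv r \<otimes> inv f"
        using f n r by (simp add: conj_conj[symmetric] K_carrier centraliser_conj_inv)
      moreover have "n \<otimes> inv (f \<otimes> n) = inv f"
        using f n by (simp add: inv_mult_group K_carrier m_assoc[symmetric])
      ultimately have "\<iota> (\<pi> n (X (f \<otimes> n, inv r))) = \<iota> (X (f, inv r))"
        using f n by (simp add: iota_X K_carrier act_act flip: act_iota)
      then show ?thesis using inj by (simp add: inj_eq)
    qed
    then have "X \<in> E"
      by (auto simp: E_space_iff X_def)
    moreover have "section_of X = t"
    proof
      fix g
      show "section_of X g = t g"
        using t by (auto simp: section_of_def S_iff iota_X Q_closed D_carrier Q_conj act_inv_act)
    qed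
    ultimately show "t \<in> section_of ` E" by blast
  qed
qed

lemma CGW_coact_eq:
  "CGW_coact G act t (f, k) x =
    (if f \<in> carrier G \<and> k \<in> carrier G \<and> x = k then act (inv f) (t (f \<otimes> k \<otimes> inv f)) else 0)"
proof (cases "f \<in> carrier G \<and> k \<in> carrier G \<and> x = k")
  case True
  have "CGW_coact G act t (f, k) x =
    (\<Sum>g\<in>carrier G. if g = f \<otimes> k \<otimes> inv f then act (inv f) (t g) else 0)"
    unfolding CGW_coact_def prod.case
  proof (intro sum.cong refl, goal_cases)
    case (1 g)
    then show ?case using True conj_eq_iff[of f g k] by auto
  qed
  then show ?thesis
    using True fin by simp
qed (auto simp: CGW_coact_def intro!: sum.neutral)

text \<open>The frames \<open>Q x\<close> and \<open>Q (a \<otimes> x \<otimes> inv a)\<close> are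
  unrelated in general. Evaluating instead with the frames \<open>c\<close> and
  \<open>a \<otimes> c\<close>, as \<open>section_of_conj\<close> permits, makes both sides
  agree.\<close>

lemma section_of_coact:
  assumes X: "X \<in> E" and i: "i \<in> basis (Dvee G)"
  shows "CGW_coact G act (section_of X) i = section_of (E_coact G sV X i)"
proof
  fix x
  obtain a b where ab: "i = (a, b)" "a \<in> carrier G" "b \<in> carrier G"
    using i by (auto simp: basis_codouble)
  show "CGW_coact G act (section_of X) i x = section_of (E_coact G sV X i) x"
  proof (cases "x \<in> D")
    case True
    then obtain c where c: "c \<in> carrier G" "x = c \<otimes> inv r \<otimes> inv c"
      by (auto simp: conj_class_def)
    have "section_of (E_coact G sV X i) x = act c (\<iota> (E_coact G sV X i (c, inv r)))"
      using section_of_conj[OF E_coact_closed[OF X]] c by simp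
    also have "\<dots> = (if b = x then act c (\<iota> (X (a \<otimes> c, inv r))) else 0)"
      using c r ab by (auto simp: E_coact_eq iota.zero act_simps)
    also have "\<dots> = CGW_coact G act (section_of X) i x"
    proof -
      have "a \<otimes> x \<otimes> inv a = (a \<otimes> c) \<otimes> inv r \<otimes> inv (a \<otimes> c)"
        using c r ab conj_conj[of a c "inv r"] by simp
      then have "act (inv a) (section_of X (a \<otimes> x \<otimes> inv a)) = act (inv a \<otimes> (a \<otimes> c)) (\<iota> (X (a \<otimes> c, inv r)))"
        using c ab section_of_conj[OF X, of "a \<otimes> c"] by (simp add: act_act)
      also have "inv a \<otimes> (a \<otimes> c) = c"
        using c ab by (simp add: m_assoc[symmetric])
      finally show ?thesis
        using ab by (auto simp: CGW_coact_eq)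
    qed
    finally show ?thesis ..
  next
    case False
    \<comment> \<open>Off \<open>D\<close> both sides vanish, since the complement of a conjugacy
      class is stable under conjugation.\<close>
    have "a \<otimes> x \<otimes> inv a \<notin> D" if "x \<in> carrier G"
    proof
      assume "a \<otimes> x \<otimes> inv a \<in> D"
      then obtain c where c: "c \<in> carrier G" "a \<otimes> x \<otimes> inv a = c \<otimes> inv r \<otimes> inv c"
        by (auto simp: conj_class_def)
      then have "x = inv a \<otimes> (c \<otimes> inv r \<otimes> inv c) \<otimes> inv (inv a)"
        using ab that r conj_eq_iff[of a "a \<otimes> x \<otimes> inv a" x] by simp
      also have "\<dots> = (inv a \<otimes> c) \<otimes> inv r \<otimes> inv (inv a \<otimes> c)"
        using ab c r by (intro conj_conj) auto
      finally have "x \<in> D" using conj_in_D[of "inv a \<otimes> c"] ab c by simp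
      with False show False by blast
    qed
    then show ?thesis
      using False ab by (auto simp: CGW_coact_eq section_of_def act_simps)
  qed
qed

lemma E_isomorphic_S:
  "left_comodule_isomorphic (Dvee G) (fscale sV) E (E_coact G sV) (fscale sW) S (CGW_coact G act)"
proof (rule left_comodule_isomorphicI[OF E_left_comodule _ _ section_of_bij])
  show "vector_space (fscale sW :: _ \<Rightarrow> ('a \<Rightarrow> 'w) \<Rightarrow> _)"
    by (rule vector_space_fscale) (rule W.vector_space_axioms)
  show "linear_map_on (fscale sV) E (fscale sW) UNIV section_of"
    by (auto simp: linear_map_on_def fun_eq_iff section_of_def fscale_def iota.add iota.scale act_simps)
  show "CGW_coact G act (section_of X) i = section_of (E_coact G sV X i)"
    if "X \<in> E" "i \<in> basis (Dvee G)" for X i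
    using that by (rule section_of_coact)
  show "CGW_coact G act t i = 0" if "i \<notin> basis (Dvee G)" for t i
    using that by (cases i) (auto simp: fun_eq_iff CGW_coact_eq basis_codouble)
qed

end

text \<open>Regularity separates classes only up to inversion, so the eigenvalue equation alone also
  admits sections over \<open>C\<close>. Hence the two forms: for \<open>C\<close> closed under
  inversion the equation determines the support, and for general \<open>C\<close> the support is
  prescribed. \<open>multiplicity_one\<close> is present because the projection selects every copy
  of the representation in \<open>W\<close>, while \<open>E\<close> accounts for one.\<close>

theorem corollary4p17:
  fixes G :: "('g, 'z) monoid_scheme" (structure)
    and C :: "'g set" and r :: 'g
    and sV :: "complex \<Rightarrow> 'v::ab_group_add \<Rightarrow> 'v" and \<pi> :: "'g \<Rightarrow> 'v \<Rightarrow> 'v"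
    and sW :: "complex \<Rightarrow> 'w::ab_group_add \<Rightarrow> 'w" and coW :: "'w \<Rightarrow> 'g \<times> 'g \<Rightarrow> 'w"
    and q Q :: "'g \<Rightarrow> 'g" and rep :: "'g set \<Rightarrow> 'g"
    and box :: "('g \<Rightarrow> complex) \<Rightarrow> ('g \<Rightarrow> complex)" and lam :: "'g set \<Rightarrow> complex"
  assumes "group G" and "finite (carrier G)"
    and "C \<in> conj_classes G" and "r \<in> C"
    and "irreducible_rep G (centraliser G r) sV \<pi>"
    and "right_comodule sW (Dvee G) coW"
    and contains: "\<exists>\<iota>. right_comodule_hom (Hquot G r) sV (V_coact G r \<pi>) sW (pushout G r coW) \<iota> \<and> inj \<iota>"
    and multiplicity_one: "\<And>\<iota> \<phi>.
      right_comodule_hom (Hquot G r) sV (V_coact G r \<pi>) sW (pushout G r coW) \<iota> \<Longrightarrow> inj \<iota> \<Longrightarrow>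
      right_comodule_hom (Hquot G r) sV (V_coact G r \<pi>) sW (pushout G r coW) \<phi> \<Longrightarrow>
      \<exists>a. \<forall>v. \<phi> v = sW a (\<iota> v)"
    and "q_section G C r q" and "q_extension G C q rep Q"
    and "covariant_op G box" and "star_compatible G box"
    and "has_class_eigenvalues G box lam" and "regular_eigenvalues G lam"
  shows "(set_inv C = C \<longrightarrow>
            left_comodule_isomorphic (Dvee G)
              (fscale sV) (E_space G r sV \<pi>) (E_coact G sV)
              (fscale sW) (solution_space G sW coW box (lam (set_inv C)) (P_rpi G r sV \<pi>) Q)
              (CGW_coact G (cm_act G coW)))
       \<and> left_comodule_isomorphic (Dvee G)
              (fscale sV) (E_space G r sV \<pi>) (E_coact G sV)
              (fscale sW) {t \<in> solution_space G sW coW box (lam (set_inv C)) (P_rpi G r sV \<pi>) Q.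
                             \<forall>g. g \<notin> set_inv C \<longrightarrow> t g = 0}
              (CGW_coact G (cm_act G coW))"
proof -
  obtain \<iota> where \<iota>: "right_comodule_hom (Hquot G r) sV (V_coact G r \<pi>) sW (pushout G r coW) \<iota>" "inj \<iota>"
    using contains by blast
  interpret group G by fact
  interpret finite_group G by unfold_locales fact
  obtain c where "c \<in> carrier G" "C = conj_class G c"
    using \<open>C \<in> conj_classes G\<close> by (auto simp: conj_classes_def)
  then have r: "r \<in> carrier G" and C: "C = conj_class G r"
    using \<open>r \<in> C\<close> conj_class_eq conj_class_subset by blast+
  have inv_C: "set_inv C = conj_class G (inv r)"
    using r C set_inv_conj_class by simp
  \<comment> \<open>Over \<open>inv c\<close> the extension uses \<open>q c\<close>. Inverting the
    relation that conjugates \<open>r\<close> to \<open>c\<close> shows that \<open>Q g\<close> is a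
    frame relative to \<open>inv r\<close>.\<close>
  have "Q g \<otimes> inv r \<otimes> inv (Q g) = g" if g: "g \<in> conj_class G (inv r)" for g
  proof -
    obtain c where c: "c \<in> C" "g = inv c"
      using g unfolding inv_C[symmetric] SET_INV_def by blast
    then have "Q g = q c" "q c \<in> carrier G" "q c \<otimes> r \<otimes> inv (q c) = c"
      using \<open>q_section G C r q\<close> \<open>q_extension G C q rep Q\<close>
      by (auto simp: q_section_def q_extension_def)
    then show ?thesis
      using c r inv_conj[of "q c" r] by simp
  qed
  then interpret framed_comodule_embedding G sW coW r sV \<pi> \<iota> Q
    using assms r \<iota> by unfold_locales (auto simp: q_extension_def)
  have D: "D \<in> conj_classes G"
    using r by (simp add: conj_classes_def)
  have lam_D: "lam (conj_class G g) = lam D" if "g \<in> D" for g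
    using that r conj_class_eq[of "inv r" g] by simp
  have solution_iff: "t \<in> solution_space G sW coW box (lam D) (P_rpi G r sV \<pi>) Q \<longleftrightarrow>
      t \<in> CGW G \<and> P_cov G sW coW (P_rpi G r sV \<pi>) Q t = t \<and>
      (\<forall>g\<in>carrier G. lam (conj_class G g) = lam D \<or> t g = 0)" for t
    using op_tensor_id_class_eigenvalues[OF \<open>has_class_eigenvalues G box lam\<close>]
    by (auto simp: solution_space_def)
  \<comment> \<open>On sections supported in \<open>D\<close> the eigenvalue equation is automatic,
    because \<open>lam\<close> is constant on the class.\<close>
  have S: "{t \<in> solution_space G sW coW box (lam (set_inv C)) (P_rpi G r sV \<pi>) Q.
      \<forall>g. g \<notin> set_inv C \<longrightarrow> t g = 0} = S"
    using lam_D unfolding inv_C solution_iff S_def by blast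
  \<comment> \<open>Regularity leaves \<open>D\<close> and its inverse, which coincide when
    \<open>C\<close> is closed under inversion.\<close>
  have "g \<in> D" if "set_inv C = C" "g \<in> carrier G" "lam (conj_class G g) = lam D" for g
  proof -
    have "conj_class G g \<in> conj_classes G"
      using that by (simp add: conj_classes_def)
    then have "conj_class G g = D \<or> conj_class G g = set_inv D"
      using \<open>regular_eigenvalues G lam\<close> D that(3) by (simp add: regular_eigenvalues_def)
    then show ?thesis
      using that inv_C conj_class_self[of g] by auto
  qed
  then have "t g = 0" if "set_inv C = C" "g \<notin> D" "t \<in> CGW G"
      "\<forall>g\<in>carrier G. lam (conj_class G g) = lam D \<or> t g = 0" for t :: "'g \<Rightarrow> 'w" and g
    using that by (cases "g \<in> carrier G") (auto simp: CGW_def)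
  then have "solution_space G sW coW box (lam (set_inv C)) (P_rpi G r sV \<pi>) Q = S" if "set_inv C = C"
    using that unfolding S[symmetric] set_eq_iff mem_Collect_eq inv_C solution_iff by metis
  then show ?thesis
    using E_isomorphic_S by (simp add: S)
qed

end
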